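(* Let $n\ge 3$ and let $\lambda\in\mathbb{R}^n$ be strictly decreasing. Then for all $N\in\mathfrak{u}_n$, the gradient flow of the function $L\mapsto\mathrm{tr}(LN)$ on $\mathcal{O}_\lambda$ in the normal metric does not strictly preserve positivity.
   Context: Here $\mathrm{i}=\sqrt{-1}$; $\mathrm{U}_n$ is the unitary group and $\mathfrak{u}_n$ the Lie algebra of skew-Hermitian $n\times n$ matrices. For weakly decreasing $\lambda\in\mathbb{R}^n$, $\mathcal{O}_\lambda=\{g(\mathrm{i}\,\mathrm{Diag}(\lambda))g^{-1}:g\in\mathrm{U}_n\}$. $\mathrm{U}_n^{>0}$ (resp. $\mathrm{U}_n^{\ge 0}$) is the set of $g\in\mathrm{U}_n$ all of whose left-justified minors (row set $I$, column set $\{1,\dots,|I|\}$) are positive (resp. nonnegative) real numbers; $\mathcal{O}_\lambda^{>0}=\{g(\mathrm{i}\,\mathrm{Diag}(\lambda))g^{-1}:g\in\mathrm{U}_n^{>0}\}$, and $\mathcal{O}_\lambda^{\ge 0}$ is its closure, equal to $\{g(\mathrm{i}\,\mathrm{Diag}(\lambda))g^{-1}:g\in\mathrm{U}_n^{\ge 0}\}$. Let $\kappa(L,M)=2n\,\mathrm{tr}(LM)-2\,\mathrm{tr}(L)\mathrm{tr}(M)$ and $\mathrm{ad}_L(X)=[L,X]=LX-XL$. The tangent space of $\mathcal{O}_\lambda$ at $L$ is $\{[L,X]:X\in\mathfrak{u}_n\}$. For $X\in\mathfrak{u}_n$ write $X=X^L+X_L$ with $X^L\in\mathrm{im}(\mathrm{ad}_L)$,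 $X_L\in\ker(\mathrm{ad}_L)$ (uniquely). The normal metric is $\langle[L,X],[L,Y]\rangle_{\mathrm{normal}}=-\kappa(X^L,Y^L)$. The gradient flow of a function $H$ is the solution of $\dot L(t)=\mathrm{grad}(H)(L(t))$ (steepest ascent), defined for all $t\in\mathbb{R}$. A flow on $\mathcal{O}_\lambda$ strictly preserves positivity if $L(t)\in\mathcal{O}_\lambda^{>0}$ for every initial point $L(0)\in\mathcal{O}_\lambda^{\ge 0}$ and all $t>0$. *)

theory Defs
  imports
    Complex_Main
    "Jordan_Normal_Form.Determinant"
    "Jordan_Normal_Form.Schur_Decomposition"
    "Jordan_Normal_Form.DL_Submatrix"
begin

text \<open>
  Matrices are the complex n-by-n matrices of Jordan_Normal_Form, with indices starting at 0, so
  the first k columns are the columns in \<open>{..<k}\<close>. A vector of real eigenvalues is a function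
  \<open>lam :: nat \<Rightarrow> real\<close> of which only the values below n are used.
\<close>

definition mat_trace :: "complex mat \<Rightarrow> complex" where
  "mat_trace A = (\<Sum>i<dim_row A. A $$ (i, i))"

definition unitary_group :: "nat \<Rightarrow> complex mat set" where
  "unitary_group n = {g \<in> carrier_mat n n. g * mat_adjoint g = 1\<^sub>m n}"

definition skew_hermitian :: "nat \<Rightarrow> complex mat set" where
  "skew_hermitian n = {X \<in> carrier_mat n n. mat_adjoint X = - X}"

definition left_justified_minor :: "complex mat \<Rightarrow> nat set \<Rightarrow> complex" where
  "left_justified_minor g I = det (submatrix g I {..<card I})"

definition unitary_pos :: "nat \<Rightarrow> complex mat set" where
  "unitary_pos n = {g \<in> unitary_group n.
     \<forall>I \<subseteq> {..<n}. left_justified_minor g I \<in> \<real> \<and> 0 < Re (left_justified_minor g I)}"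

text \<open>For unitary g the inverse of g is its adjoint.\<close>

definition conj_diag :: "nat \<Rightarrow> (nat \<Rightarrow> real) \<Rightarrow> complex mat \<Rightarrow> complex mat" where
  "conj_diag n lam g = g * (\<i> \<cdot>\<^sub>m mat_diag n (\<lambda>i. complex_of_real (lam i))) * mat_adjoint g"

definition adj_orbit :: "nat \<Rightarrow> (nat \<Rightarrow> real) \<Rightarrow> complex mat set" where
  "adj_orbit n lam = conj_diag n lam ` unitary_group n"

definition adj_orbit_pos :: "nat \<Rightarrow> (nat \<Rightarrow> real) \<Rightarrow> complex mat set" where
  "adj_orbit_pos n lam = conj_diag n lam ` unitary_pos n"

text \<open>
  The type of matrices carries no topology; this is the closure in the space of n-by-n matrices
  with respect to the maximum norm of the entries.
\<close>

definition mat_closure :: "nat \<Rightarrow> complex mat set \<Rightarrow> complex mat set" where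
  "mat_closure n S = {A \<in> carrier_mat n n.
     \<forall>e>0. \<exists>B\<in>S. \<forall>i<n. \<forall>j<n. cmod (B $$ (i, j) - A $$ (i, j)) < e}"

definition adj_orbit_nonneg :: "nat \<Rightarrow> (nat \<Rightarrow> real) \<Rightarrow> complex mat set" where
  "adj_orbit_nonneg n lam = mat_closure n (adj_orbit_pos n lam)"

definition kappa :: "nat \<Rightarrow> complex mat \<Rightarrow> complex mat \<Rightarrow> complex" where
  "kappa n L M = 2 * of_nat n * mat_trace (L * M) - 2 * mat_trace L * mat_trace M"

definition ad :: "complex mat \<Rightarrow> complex mat \<Rightarrow> complex mat" where
  "ad L X = L * X - X * L"

definition ad_image :: "nat \<Rightarrow> complex mat \<Rightarrow> complex mat set" where
  "ad_image n L = ad L ` skew_hermitian n"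

definition ad_kernel :: "nat \<Rightarrow> complex mat \<Rightarrow> complex mat set" where
  "ad_kernel n L = {X \<in> skew_hermitian n. ad L X = 0\<^sub>m n n}"

text \<open>The tangent space of the orbit at L is the same set as the image of \<open>ad L\<close>.\<close>

abbreviation tangent_space :: "nat \<Rightarrow> complex mat \<Rightarrow> complex mat set" where
  "tangent_space n L \<equiv> ad_image n L"

text \<open>The component of X in the image of \<open>ad L\<close>, along the kernel of \<open>ad L\<close>.\<close>

definition im_part :: "nat \<Rightarrow> complex mat \<Rightarrow> complex mat \<Rightarrow> complex mat" where
  "im_part n L X = (THE A. A \<in> ad_image n L \<and> X - A \<in> ad_kernel n L)"

text \<open>
  The value on tangent vectors V = [L, X] and W = [L, Y] does not depend on the choice of X and Y,
  since the components of X and Y in the image of \<open>ad L\<close> do not. The form \<open>kappa\<close> is real on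
  skew-Hermitian matrices, so taking the real part loses nothing.
\<close>

definition normal_metric :: "nat \<Rightarrow> complex mat \<Rightarrow> complex mat \<Rightarrow> complex mat \<Rightarrow> real" where
  "normal_metric n L V W = (THE r. \<exists>X \<in> skew_hermitian n. \<exists>Y \<in> skew_hermitian n.
     V = ad L X \<and> W = ad L Y \<and> r = - Re (kappa n (im_part n L X) (im_part n L Y)))"

definition has_mat_derivative ::
    "nat \<Rightarrow> (real \<Rightarrow> complex mat) \<Rightarrow> complex mat \<Rightarrow> real \<Rightarrow> bool" where
  "has_mat_derivative n c V t \<longleftrightarrow> V \<in> carrier_mat n n \<and>
     (\<forall>i<n. \<forall>j<n. ((\<lambda>s. c s $$ (i, j)) has_vector_derivative V $$ (i, j)) (at t))"

text \<open>
  V is the gradient of H at L: the differential of H at L, evaluated on a tangent vector W by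
  differentiating H along the curves in the orbit through L with velocity W, is the inner product
  with V.
\<close>

definition is_gradient ::
    "nat \<Rightarrow> (nat \<Rightarrow> real) \<Rightarrow> (complex mat \<Rightarrow> real) \<Rightarrow> complex mat \<Rightarrow> complex mat \<Rightarrow> bool" where
  "is_gradient n lam H L V \<longleftrightarrow> V \<in> tangent_space n L \<and>
     (\<forall>W \<in> tangent_space n L. \<forall>c.
        (\<forall>s. c s \<in> adj_orbit n lam) \<and> c 0 = L \<and> has_mat_derivative n c W 0 \<longrightarrow>
        ((\<lambda>s. H (c s)) has_real_derivative normal_metric n L V W) (at 0))"

text \<open>
  The gradient flow is represented by the set of its trajectories, the solutions in the orbit of
  L'(t) = grad(H)(L(t)) defined for all real t.
\<close>

definition gradient_flow ::
    "nat \<Rightarrow> (nat \<Rightarrow> real) \<Rightarrow> (complex mat \<Rightarrow> real) \<Rightarrow> (real \<Rightarrow> complex mat) set" where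
  "gradient_flow n lam H = {L. (\<forall>t. L t \<in> adj_orbit n lam) \<and>
     (\<forall>t. \<exists>V. is_gradient n lam H (L t) V \<and> has_mat_derivative n L V t)}"

definition strictly_preserves_positivity ::
    "nat \<Rightarrow> (nat \<Rightarrow> real) \<Rightarrow> (real \<Rightarrow> complex mat) set \<Rightarrow> bool" where
  "strictly_preserves_positivity n lam F \<longleftrightarrow>
     (\<forall>L\<in>F. L 0 \<in> adj_orbit_nonneg n lam \<longrightarrow> (\<forall>t>0. L t \<in> adj_orbit_pos n lam))"

end

theory Submission
  imports
    Defs
    "HOL-Probability.Discrete_Topology"
begin

text \<open>
  Write D = i Diag(\<open>\<lambda>\<close>). In the normal metric the gradient of tr(LN) is [L,[L,N]]/(2n), and the flow
  lifts along L = g D g* to g' = g K(g) with K(g) = [g* N g, D]/(2n), so that K(g) has the entries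
  i(\<open>\<lambda>\<close>_j - \<open>\<lambda>\<close>_i)(g* N g)_ij/(2n). The left-justified minors of a given size of a frame of a point of the
  positive part have positive quotients. Suppose positivity were strictly preserved, and start the
  flow at the boundary frames that rotate the coordinates 1 and 2 (counted from 0) by an acute angle and
  fix the others. Minors of sizes 1 and 2 that vanish at time 0 must have a nonnegative derivative
  there. Because the weights \<open>\<lambda>\<close>_0 - \<open>\<lambda>\<close>_1 < \<open>\<lambda>\<close>_0 - \<open>\<lambda>\<close>_2 differ, these inequalities for all angles force
  N_i0 = 0 for all i > 0. But then the flow preserves the set of frames whose first column is a
  multiple of e_0, and these are never positive.

  The rotations lie in the closure of the positive frames because Gram-Schmidt orthonormalization
  preserves the signs of left-justified minors and is continuous, and because the rotations are
  Gram-Schmidt limits of rescaled Vandermonde matrices.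
\<close>

text \<open>Strict preservation is a claim about all trajectories, so it can only be refuted by
  exhibiting some; hence the existence theorem for all times. The final invariant set is handled in
  the same way: the trajectory is constructed inside it. Only quotients of minors of equal size can
  be compared, because distinct eigenvalues determine a frame no further than up to scalar factors
  of its columns. The rotations are chosen because their column 0 is e_0: the minors on the row sets
  {i} and {1,i} then start at 0, and their first derivatives are linear in column 0 of N. The
  rotation mixes N_10 and N_20, the eigenvalue gaps weight the mixtures, and rotating back undoes
  the mixing only for equal weights. With equal weights, N_20 = 0 and any i N_10 >= 0 would pass
  every test on rows 1 and 2; the unequal gaps remove this last cone. Two coordinates besides e_0
  are needed for this, which is where n >= 3 enters.\<close>

hide_const (open) Finite_Cartesian_Product.mat Determinants.det

section \<open>Picard iteration on the real line\<close>

text \<open>Makes the matrices, transported below to functions on a discrete set of index pairs, an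
  admissible value space for the Picard theorem.\<close>

instance bcontfun :: (metric_space, banach) banach ..

text \<open>Covers both signs of t at once: one of the two intervals is always empty or a single
  point, so its integral vanishes.\<close>

definition signed_integral :: "(real \<Rightarrow> 'a::banach) \<Rightarrow> real \<Rightarrow> 'a" where
  "signed_integral f t = integral {0..t} f - integral {t..0} f"

text \<open>Around t the function differs by a constant from the integral over {-T..s} with a fixed
  T > |t|, so the fundamental theorem on one interval covers negative points and 0 as well.\<close>

lemma signed_integral_has_vector_derivative:
  fixes f :: "real \<Rightarrow> 'a::banach"
  assumes "continuous_on UNIV f"
  shows "(signed_integral f has_vector_derivative f t) (at t)"
proof -
  define T where "T = \<bar>t\<bar> + 1"
  have int: "f integrable_on {a..b}" for a b
    using assms by (meson continuous_on_subset integrable_continuous_interval top_greatest)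
  have eq: "signed_integral f s = integral {-T..s} f - integral {-T..0} f" if "s \<in> {-T<..<T}" for s
  proof (cases "s \<ge> 0")
    case True
    have "integral {-T..0} f + integral {0..s} f = integral {-T..s} f"
      using that True by (intro Henstock_Kurzweil_Integration.integral_combine int) auto
    moreover have "integral {s..0} f = 0"
      using True by (cases "s = 0") auto
    ultimately show ?thesis
      by (simp add: signed_integral_def algebra_simps)
  next
    case False
    have "integral {-T..s} f + integral {s..0} f = integral {-T..0} f"
      using that False by (intro Henstock_Kurzweil_Integration.integral_combine int) auto
    then show ?thesis
      using False by (simp add: signed_integral_def algebra_simps)
  qed
  have t: "t \<in> {-T<..<T}" by (auto simp: T_def)
  have "((\<lambda>s. integral {-T..s} f) has_vector_derivative f t) (at t within {-T..T})"
    using t assms by (intro integral_has_vector_derivative) (auto intro: continuous_on_subset)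
  then have "((\<lambda>s. integral {-T..s} f) has_vector_derivative f t) (at t)"
    using t by (metis at_within_interior greaterThanLessThan_iff interior_atLeastAtMost_real)
  then have "((\<lambda>s. integral {-T..s} f - integral {-T..0} f) has_vector_derivative f t) (at t)"
    by (auto intro!: derivative_eq_intros)
  then show ?thesis
    by (rule has_vector_derivative_transform_within_open[where S = "{-T<..<T}"]) (use t eq in auto)
qed

lemma signed_integral_0 [simp]: "signed_integral f 0 = 0"
  by (simp add: signed_integral_def)

text \<open>The mean value inequality on the positive axis, carried to the negative axis by the
  reflection s -> -s. It keeps the Picard operator in the weighted space, makes it contract, and
  with a constant comparison function shows that a vanishing derivative forces a vanishing
  function.\<close>

lemma antiderivative_norm_bound:
  fixes G :: "real \<Rightarrow> 'a::real_normed_vector"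
  assumes G: "\<And>t. (G has_vector_derivative h t) (at t)" and "G 0 = 0"
    and \<phi>: "\<And>t. (\<phi> has_vector_derivative \<phi>' t) (at t)"
    and bound: "\<And>t. norm (h t) \<le> \<phi>' \<bar>t\<bar>"
  shows "norm (G t) \<le> \<phi> \<bar>t\<bar> - \<phi> 0"
proof -
  have pos: "norm (G s) \<le> \<phi> s - \<phi> 0" if "s > 0" "G 0 = 0" "\<And>t. norm (h t) \<le> \<phi>' \<bar>t\<bar>"
    "\<And>t. (G has_vector_derivative h t) (at t)" for s h and G :: "real \<Rightarrow> 'a"
  proof -
    have "norm (G s - G 0) \<le> \<phi> s - \<phi> 0"
    proof (rule differentiable_bound_general[where f' = h and \<phi>' = \<phi>'])
      show "norm (h x) \<le> \<phi>' x" if "0 < x" for x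
        using \<open>\<And>t. norm (h t) \<le> \<phi>' \<bar>t\<bar>\<close>[of x] that by simp
    qed (use that \<phi> in \<open>auto intro!: continuous_at_imp_continuous_on has_vector_derivative_continuous\<close>)
    with that show ?thesis by simp
  qed
  have refl: "((\<lambda>s. G (- s)) has_vector_derivative - h (- s)) (at s)" for s
  proof -
    have "(uminus has_vector_derivative -1) (at s)"
      by (auto intro!: derivative_eq_intros)
    from vector_diff_chain_at[OF this G] show ?thesis
      by (simp add: o_def)
  qed
  consider "t > 0" | "t < 0" | "t = 0" by linarith
  then show ?thesis
  proof cases
    case 1
    with pos[of t G h] assms show ?thesis by simp
  next
    case 2
    with pos[of "-t" "\<lambda>s. G (-s)" "\<lambda>s. - h (- s)"] assms refl show ?thesis
      by (simp add: abs_minus_commute) (metis abs_minus_cancel)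
  qed (use assms in auto)
qed

text \<open>
  With the weight \<open>exp (2 * K * \<bar>t\<bar>)\<close> in the supremum norm, the Picard operator is a contraction
  on the whole real line at once.
\<close>

theorem picard_lindeloef_bounded:
  fixes F :: "'a::banach \<Rightarrow> 'a"
  assumes B: "\<And>x. norm (F x) \<le> B" and K: "\<And>x y. norm (F x - F y) \<le> K * norm (x - y)"
  obtains x where "x 0 = init" "\<And>t. (x has_vector_derivative F (x t)) (at t)"
proof -
  define k where "k = max K 1"
  have k: "k > 0" "norm (F x - F y) \<le> k * norm (x - y)" for x y
    using K[of x y] mult_right_mono[of K k "norm (x - y)"] by (auto simp: k_def)
  have F_cont: "continuous_on UNIV F"
    using k by (intro lipschitz_on_continuous_on[of k] lipschitz_onI) (auto simp: dist_norm)
  define w where "w t = exp (2 * k * \<bar>t\<bar>)" for t :: real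
  have w: "w t > 0" for t by (simp add: w_def)
  have w_cont: "continuous_on UNIV w"
    unfolding w_def by (intro continuous_intros)
  \<comment> \<open>The bounded function \<open>y\<close> encodes the path
    \<open>w s *\<^sub>R y s\<close>, which may itself grow exponentially.\<close>
  define f where "f y s = F (w s *\<^sub>R apply_bcontfun y s)" for y and s :: real
  have f_cont: "continuous_on UNIV (f y)" for y
    unfolding f_def
    by (rule continuous_on_compose2[OF F_cont]) (auto intro!: continuous_intros w_cont)
  define x where "x y t = init + signed_integral (f y) t" for y t
  have x: "(x y has_vector_derivative f y t) (at t)" for y t
    unfolding x_def
    using signed_integral_has_vector_derivative[OF f_cont] by (auto intro!: derivative_eq_intros)
  have x_cont: "continuous_on UNIV (x y)" for y
    using x by (auto intro!: continuous_at_imp_continuous_on has_vector_derivative_continuous)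
  have "B \<ge> 0" using B[of 0] norm_ge_zero order_trans by blast
  have "(\<lambda>t. x y t /\<^sub>R w t) \<in> bcontfun" for y
  proof (rule bcontfun_normI)
    show "continuous_on UNIV (\<lambda>t. x y t /\<^sub>R w t)"
      using w by (intro continuous_intros x_cont w_cont) (auto simp: less_imp_neq[symmetric])
    fix t
    have "norm (signed_integral (f y) t) \<le> B * \<bar>t\<bar> - B * 0"
      by (rule antiderivative_norm_bound[OF signed_integral_has_vector_derivative[OF f_cont]])
        (auto simp: f_def B intro!: derivative_eq_intros)
    \<comment> \<open>The path grows at most linearly because \<open>F\<close> is bounded, and the
      exponential weight dominates linear growth.\<close>
    moreover have "1 + 2 * k * \<bar>t\<bar> \<le> w t"
      unfolding w_def by (rule exp_ge_add_one_self)
    then have "1 \<le> w t" "\<bar>t\<bar> \<le> w t / (2 * k)"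
      using k by (auto simp: field_simps) (smt (verit) mult_nonneg_nonneg abs_ge_zero)
    moreover from \<open>B \<ge> 0\<close> this have "norm init * 1 \<le> norm init * w t" "B * \<bar>t\<bar> \<le> B * (w t / (2 * k))"
      by (intro mult_left_mono; simp)+
    ultimately have "norm (x y t) \<le> norm init * w t + B * (w t / (2 * k))"
      unfolding x_def by (intro norm_triangle_le) linarith
    then show "norm (x y t /\<^sub>R w t) \<le> norm init + B / (2 * k)"
      using w[of t] by (auto simp: field_simps)
  qed
  then have T: "apply_bcontfun (Bcontfun (\<lambda>t. x y t /\<^sub>R w t)) = (\<lambda>t. x y t /\<^sub>R w t)" for y
    by (rule Bcontfun_inverse)
  define P where "P y = Bcontfun (\<lambda>t. x y t /\<^sub>R w t)" for y
  have "dist (P y) (P z) \<le> 1/2 * dist y z" for y z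
  proof (rule dist_bound)
    fix t
    \<comment> \<open>The rate 2k is twice the Lipschitz constant: integrating k exp(2ks) from 0 to
      t gives at most half of the weight exp(2kt), which is the contraction factor 1/2.\<close>
    have "norm (signed_integral (f y) t - signed_integral (f z) t)
      \<le> dist y z / 2 * exp (2 * k * \<bar>t\<bar>) - dist y z / 2 * exp (2 * k * 0)"
    proof (rule antiderivative_norm_bound[where h = "\<lambda>s. f y s - f z s"
          and \<phi>' = "\<lambda>s. k * exp (2 * k * s) * dist y z"])
      fix s
      have "norm (f y s - f z s) \<le> k * norm (w s *\<^sub>R (apply_bcontfun y s - apply_bcontfun z s))"
        unfolding f_def using k by (simp add: scaleR_diff_right)
      also have "\<dots> \<le> k * (w s * dist y z)"
        using w[of s] k dist_bounded[of y s z] by (auto simp: dist_norm intro!: mult_left_mono)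
      finally show "norm (f y s - f z s) \<le> k * exp (2 * k * \<bar>s\<bar>) * dist y z"
        by (simp add: w_def mult.assoc)
      show "((\<lambda>s. signed_integral (f y) s - signed_integral (f z) s) has_vector_derivative
          f y s - f z s) (at s)"
        by (intro has_vector_derivative_diff signed_integral_has_vector_derivative f_cont)
      show "((\<lambda>s. dist y z / 2 * exp (2 * k * s)) has_vector_derivative
          k * exp (2 * k * s) * dist y z) (at s)"
        unfolding has_real_derivative_iff_has_vector_derivative[symmetric]
        by (auto intro!: derivative_eq_intros)
    qed auto
    also have "\<dots> \<le> dist y z / 2 * w t"
      by (simp add: w_def)
    finally have "norm (x y t - x z t) \<le> dist y z / 2 * w t"
      by (simp add: x_def)
    moreover have "norm (x y t /\<^sub>R w t - x z t /\<^sub>R w t) = norm (x y t - x z t) / w t"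
      using w[of t] by (simp flip: scaleR_diff_right add: divide_inverse)
    ultimately show "dist (apply_bcontfun (P y) t) (apply_bcontfun (P z) t) \<le> 1/2 * dist y z"
      using w[of t] unfolding P_def T dist_norm by (simp add: divide_le_eq)
  qed
  then obtain y where y: "P y = y"
    using banach_fix_type[of "1/2" P] by auto
  have "x y t = w t *\<^sub>R apply_bcontfun y t" for t
    using w[of t] by (subst y[symmetric]) (simp add: P_def T)
  then have "f y t = F (x y t)" for t
    by (simp add: f_def)
  with x have "(x y has_vector_derivative F (x y t)) (at t)" for t
    by metis
  moreover have "x y 0 = init"
    by (simp add: x_def)
  ultimately show thesis
    using that by blast
qed

section \<open>Adjoints and entrywise calculus of matrices\<close>

lemma dim_mat_adjoint [simp]: "dim_row (mat_adjoint A) = dim_col A" "dim_col (mat_adjoint A) = dim_row A"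
  by (simp_all add: mat_adjoint_def)

lemma mat_adjoint_carrier [simp]: "A \<in> carrier_mat n m \<Longrightarrow> mat_adjoint A \<in> carrier_mat m n"
  by auto

lemma index_mat_adjoint [simp]:
  fixes A :: "complex mat"
  shows "i < dim_col A \<Longrightarrow> j < dim_row A \<Longrightarrow> mat_adjoint A $$ (i, j) = cnj (A $$ (j, i))"
  by (simp add: mat_adjoint_def mat_of_rows_def)

lemma index_mult_mat_sum:
  assumes "A \<in> carrier_mat n m" "B \<in> carrier_mat m k" "i < n" "j < k"
  shows "(A * B) $$ (i, j) = (\<Sum>l<m. A $$ (i, l) * B $$ (l, j))"
  using assms by (auto simp: scalar_prod_def lessThan_atLeast0)

lemma mat_adjoint_mult:
  fixes A B :: "complex mat"
  assumes "A \<in> carrier_mat n m" "B \<in> carrier_mat m k"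
  shows "mat_adjoint (A * B) = mat_adjoint B * mat_adjoint A"
proof (rule eq_matI)
  fix i j assume "i < dim_row (mat_adjoint B * mat_adjoint A)" "j < dim_col (mat_adjoint B * mat_adjoint A)"
  then have ij: "i < k" "j < n" using assms by auto
  have "mat_adjoint (A * B) $$ (i, j) = cnj ((A * B) $$ (j, i))"
    using ij assms by (intro index_mat_adjoint) auto
  also have "\<dots> = (\<Sum>l<m. cnj (A $$ (j, l)) * cnj (B $$ (l, i)))"
    by (simp add: index_mult_mat_sum[OF assms ij(2,1)])
  also have "\<dots> = (mat_adjoint B * mat_adjoint A) $$ (i, j)"
    using ij assms by (subst index_mult_mat_sum[where m = m]) (auto intro!: sum.cong simp: mult.commute)
  finally show "mat_adjoint (A * B) $$ (i, j) = (mat_adjoint B * mat_adjoint A) $$ (i, j)" .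
qed (use assms in auto)

lemma mat_adjoint_adjoint [simp]: "mat_adjoint (mat_adjoint A) = (A :: complex mat)"
  by (rule eq_matI) auto

lemma mat_adjoint_minus:
  fixes A B :: "complex mat"
  assumes "A \<in> carrier_mat n m" "B \<in> carrier_mat n m"
  shows "mat_adjoint (A - B) = mat_adjoint A - mat_adjoint B"
  using assms by (intro eq_matI) auto

lemma mat_adjoint_smult: "mat_adjoint (c \<cdot>\<^sub>m A) = cnj c \<cdot>\<^sub>m mat_adjoint (A :: complex mat)"
  by (intro eq_matI) auto

text \<open>Boundedness is included because a product of unbounded Lipschitz functions is in general
  not Lipschitz. With it, the class is closed under all operations from which the vector field is
  built.\<close>

definition bdd_lipschitz :: "('a::real_normed_vector \<Rightarrow> 'b::real_normed_vector) \<Rightarrow> bool" where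
  "bdd_lipschitz f \<longleftrightarrow> (\<exists>K. \<forall>x y. norm (f x) \<le> K \<and> norm (f x - f y) \<le> K * norm (x - y))"

lemma bdd_lipschitzI:
  assumes "\<And>x. norm (f x) \<le> B" "\<And>x y. norm (f x - f y) \<le> K * norm (x - y)"
  shows "bdd_lipschitz f"
  unfolding bdd_lipschitz_def
proof (intro exI allI conjI)
  fix x y
  show "norm (f x) \<le> max B K" using assms(1)[of x] by simp
  show "norm (f x - f y) \<le> max B K * norm (x - y)"
    using assms(2)[of x y] mult_right_mono[of K "max B K" "norm (x - y)"] by simp
qed

lemma bdd_lipschitzE:
  assumes "bdd_lipschitz f"
  obtains K where "K \<ge> 0" "\<And>x. norm (f x) \<le> K" "\<And>x y. norm (f x - f y) \<le> K * norm (x - y)"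
  using assms unfolding bdd_lipschitz_def by (meson norm_ge_zero order_trans)

lemma bdd_lipschitz_const: "bdd_lipschitz (\<lambda>_. c)"
  by (rule bdd_lipschitzI[of _ "norm c" 0]) auto

lemma bdd_lipschitz_diff:
  assumes "bdd_lipschitz f" "bdd_lipschitz g"
  shows "bdd_lipschitz (\<lambda>x. f x - g x)"
proof -
  obtain K where K: "K \<ge> 0" "\<And>x. norm (f x) \<le> K" "\<And>x y. norm (f x - f y) \<le> K * norm (x - y)"
    using assms(1) by (rule bdd_lipschitzE) blast
  obtain M where M: "M \<ge> 0" "\<And>x. norm (g x) \<le> M" "\<And>x y. norm (g x - g y) \<le> M * norm (x - y)"
    using assms(2) by (rule bdd_lipschitzE) blast
  show ?thesis
  proof (rule bdd_lipschitzI)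
    fix x y
    show "norm (f x - g x) \<le> K + M"
      using norm_triangle_ineq4[of "f x" "g x"] K(2)[of x] M(2)[of x] by linarith
    have "norm (f x - g x - (f y - g y)) \<le> norm (f x - f y) + norm (g x - g y)"
      using norm_triangle_ineq4[of "f x - f y" "g x - g y"] by (simp add: algebra_simps)
    then show "norm (f x - g x - (f y - g y)) \<le> (K + M) * norm (x - y)"
      using K(3)[of x y] M(3)[of x y] by (simp add: distrib_right)
  qed
qed

lemma bdd_lipschitz_mult:
  fixes f g :: "'a::real_normed_vector \<Rightarrow> 'b::real_normed_algebra"
  assumes "bdd_lipschitz f" "bdd_lipschitz g"
  shows "bdd_lipschitz (\<lambda>x. f x * g x)"
proof -
  obtain K where K: "K \<ge> 0" "\<And>x. norm (f x) \<le> K" "\<And>x y. norm (f x - f y) \<le> K * norm (x - y)"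
    using assms(1) by (rule bdd_lipschitzE) blast
  obtain M where M: "M \<ge> 0" "\<And>x. norm (g x) \<le> M" "\<And>x y. norm (g x - g y) \<le> M * norm (x - y)"
    using assms(2) by (rule bdd_lipschitzE) blast
  show ?thesis
  proof (rule bdd_lipschitzI)
    fix x y
    show "norm (f x * g x) \<le> K * M"
      using K M by (intro norm_mult_ineq[THEN order_trans] mult_mono) auto
    have "norm (f x * g x - f y * g y) = norm ((f x - f y) * g x + f y * (g x - g y))"
      by (simp add: algebra_simps)
    also have "\<dots> \<le> norm (f x - f y) * norm (g x) + norm (f y) * norm (g x - g y)"
      by (intro norm_triangle_mono norm_mult_ineq)
    also have "\<dots> \<le> (K * norm (x - y)) * M + K * (M * norm (x - y))"
      using K M by (intro add_mono mult_mono) auto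
    finally show "norm (f x * g x - f y * g y) \<le> (2 * K * M) * norm (x - y)"
      by (simp add: algebra_simps)
  qed
qed

lemma bdd_lipschitz_sum:
  assumes "\<And>i. i \<in> I \<Longrightarrow> bdd_lipschitz (f i)"
  shows "bdd_lipschitz (\<lambda>x. \<Sum>i\<in>I. f i x)"
  using assms
proof (induction I rule: infinite_finite_induct)
  case (insert i I)
  then have "bdd_lipschitz (\<lambda>x. f i x - (0 - (\<Sum>i\<in>I. f i x)))"
    by (intro bdd_lipschitz_diff bdd_lipschitz_const) auto
  with insert show ?case by simp
qed (auto intro: bdd_lipschitz_const)

lemma bdd_lipschitz_cnj: "bdd_lipschitz f \<Longrightarrow> bdd_lipschitz (\<lambda>x. cnj (f x))"
  unfolding bdd_lipschitz_def by (simp flip: complex_cnj_diff)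

text \<open>With a and b the two denominators, the increment splits into (x - y) / a and a multiple
  of y. As y / b lies in the unit ball and |b - a| is at most the norm of x - y, each part is at
  most that norm, which gives the constant 2.\<close>

lemma bdd_lipschitz_radial_retraction: "bdd_lipschitz (\<lambda>x. x /\<^sub>R max 1 (norm x))"
proof (rule bdd_lipschitzI)
  fix x y :: 'a
  show "norm (x /\<^sub>R max 1 (norm x)) \<le> 1"
    by (simp add: divide_simps max_def)
  define a b where "a = max 1 (norm x)" and "b = max 1 (norm y)"
  have ab: "a \<ge> 1" "b \<ge> 1" "norm y \<le> b" "\<bar>b - a\<bar> \<le> norm (x - y)"
    using norm_triangle_ineq3[of x y] by (auto simp: a_def b_def max_def)
  have "x /\<^sub>R a - y /\<^sub>R b = (x - y) /\<^sub>R a + ((b - a) / (a * b)) *\<^sub>R y"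
  proof -
    have "(b - a) / (a * b) = inverse a - inverse b"
      using ab by (simp add: field_simps)
    then show ?thesis
      by (simp add: scaleR_diff_right scaleR_diff_left)
  qed
  then have "norm (x /\<^sub>R a - y /\<^sub>R b) \<le> norm ((x - y) /\<^sub>R a) + norm (((b - a) / (a * b)) *\<^sub>R y)"
    by (metis norm_triangle_ineq)
  also have "norm ((x - y) /\<^sub>R a) \<le> norm (x - y)"
    using ab mult_left_mono[of 1 a "norm (x - y)"] by (simp add: divide_simps)
  also have "norm (((b - a) / (a * b)) *\<^sub>R y) = \<bar>b - a\<bar> * (norm y / b) * (1 / a)"
    using ab by (simp add: abs_mult)
  also have "\<dots> \<le> norm (x - y) * 1 * 1"
    using ab by (intro mult_mono) auto
  finally show "norm (x /\<^sub>R max 1 (norm x) - y /\<^sub>R max 1 (norm y)) \<le> 2 * norm (x - y)"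
    by (simp add: a_def b_def)
qed

definition mat_bdd_lipschitz :: "nat \<Rightarrow> ('a::real_normed_vector \<Rightarrow> complex mat) \<Rightarrow> bool" where
  "mat_bdd_lipschitz n f \<longleftrightarrow> (\<forall>x. f x \<in> carrier_mat n n) \<and>
     (\<forall>i<n. \<forall>j<n. bdd_lipschitz (\<lambda>x. f x $$ (i, j)))"

lemma mat_bdd_lipschitzI:
  assumes "\<And>x. f x \<in> carrier_mat n n"
    and "\<And>x i j. i < n \<Longrightarrow> j < n \<Longrightarrow> f x $$ (i, j) = \<phi> i j x"
    and "\<And>i j. i < n \<Longrightarrow> j < n \<Longrightarrow> bdd_lipschitz (\<phi> i j)"
  shows "mat_bdd_lipschitz n f"
  using assms by (simp add: mat_bdd_lipschitz_def)

lemma mat_bdd_lipschitzD: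
  assumes "mat_bdd_lipschitz n f"
  shows "f x \<in> carrier_mat n n" "dim_row (f x) = n" "dim_col (f x) = n"
    "i < n \<Longrightarrow> j < n \<Longrightarrow> bdd_lipschitz (\<lambda>x. f x $$ (i, j))"
proof -
  show "f x \<in> carrier_mat n n"
    using assms by (simp add: mat_bdd_lipschitz_def)
  then show "dim_row (f x) = n" "dim_col (f x) = n"
    by auto
qed (use assms in \<open>simp add: mat_bdd_lipschitz_def\<close>)

lemma mat_bdd_lipschitz_const: "A \<in> carrier_mat n n \<Longrightarrow> mat_bdd_lipschitz n (\<lambda>_. A)"
  by (simp add: mat_bdd_lipschitz_def bdd_lipschitz_const)

lemma mat_bdd_lipschitz_diff:
  "mat_bdd_lipschitz n f \<Longrightarrow> mat_bdd_lipschitz n g \<Longrightarrow> mat_bdd_lipschitz n (\<lambda>x. f x - g x)"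
  by (rule mat_bdd_lipschitzI[where \<phi> = "\<lambda>i j x. f x $$ (i, j) - g x $$ (i, j)"])
    (auto simp: mat_bdd_lipschitzD minus_carrier_mat intro!: bdd_lipschitz_diff)

lemma mat_bdd_lipschitz_mult:
  "mat_bdd_lipschitz n f \<Longrightarrow> mat_bdd_lipschitz n g \<Longrightarrow> mat_bdd_lipschitz n (\<lambda>x. f x * g x)"
  by (rule mat_bdd_lipschitzI[where \<phi> = "\<lambda>i j x. \<Sum>l<n. f x $$ (i, l) * g x $$ (l, j)"])
    (auto simp: mat_bdd_lipschitzD index_mult_mat_sum[of _ n n _ n] simp del: index_mult_mat(1)
      intro!: bdd_lipschitz_sum bdd_lipschitz_mult mult_carrier_mat[of _ n n])

lemma mat_bdd_lipschitz_smult: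
  "mat_bdd_lipschitz n f \<Longrightarrow> mat_bdd_lipschitz n (\<lambda>x. c \<cdot>\<^sub>m f x)"
  by (rule mat_bdd_lipschitzI[where \<phi> = "\<lambda>i j x. c * f x $$ (i, j)"])
    (auto simp: mat_bdd_lipschitzD intro!: bdd_lipschitz_mult bdd_lipschitz_const)

lemma mat_bdd_lipschitz_adjoint:
  "mat_bdd_lipschitz n f \<Longrightarrow> mat_bdd_lipschitz n (\<lambda>x. mat_adjoint (f x))"
  by (rule mat_bdd_lipschitzI[where \<phi> = "\<lambda>i j x. cnj (f x $$ (j, i))"])
    (auto simp: mat_bdd_lipschitzD intro!: bdd_lipschitz_cnj)

section \<open>Derivatives of curves of matrices\<close>

lemma has_mat_derivative_index:
  "has_mat_derivative n c V t \<Longrightarrow> i < n \<Longrightarrow> j < n \<Longrightarrow>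
    ((\<lambda>s. c s $$ (i, j)) has_vector_derivative V $$ (i, j)) (at t)"
  by (simp add: has_mat_derivative_def)

lemma has_mat_derivative_const: "A \<in> carrier_mat n n \<Longrightarrow> has_mat_derivative n (\<lambda>_. A) (0\<^sub>m n n) t"
  by (simp add: has_mat_derivative_def)

lemma has_mat_derivative_mult:
  assumes "has_mat_derivative n c V t" "has_mat_derivative n d W t"
    and c: "\<And>s. c s \<in> carrier_mat n n" and d: "\<And>s. d s \<in> carrier_mat n n"
  shows "has_mat_derivative n (\<lambda>s. c s * d s) (c t * W + V * d t) t"
proof -
  have VW: "V \<in> carrier_mat n n" "W \<in> carrier_mat n n"
    using assms by (auto simp: has_mat_derivative_def)
  have "((\<lambda>s. (c s * d s) $$ (i, j)) has_vector_derivative (c t * W + V * d t) $$ (i, j)) (at t)"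
    if ij: "i < n" "j < n" for i j
  proof -
    have eq: "(\<lambda>s. (c s * d s) $$ (i, j)) = (\<lambda>s. \<Sum>l<n. c s $$ (i, l) * d s $$ (l, j))"
      using index_mult_mat_sum[OF c d ij] by auto
    have eq': "(c t * W + V * d t) $$ (i, j)
        = (\<Sum>l<n. c t $$ (i, l) * W $$ (l, j) + V $$ (i, l) * d t $$ (l, j))"
      using index_mult_mat_sum[OF c VW(2) ij, of t] index_mult_mat_sum[OF VW(1) d ij, of t] ij VW d[of t]
      by (simp add: sum.distrib)
    show ?thesis
      unfolding eq eq' using assms ij
      by (intro has_vector_derivative_sum has_vector_derivative_mult) (auto simp: has_mat_derivative_def)
  qed
  then show ?thesis
    using VW c[of t] d[of t] by (simp add: has_mat_derivative_def)
qed

lemma has_mat_derivative_adjoint: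
  assumes "has_mat_derivative n c V t" and c: "\<And>s. c s \<in> carrier_mat n n"
  shows "has_mat_derivative n (\<lambda>s. mat_adjoint (c s)) (mat_adjoint V) t"
proof -
  have V: "V \<in> carrier_mat n n"
    using assms by (auto simp: has_mat_derivative_def)
  have "dim_row (c s) = n" "dim_col (c s) = n" for s
    using c[of s] by auto
  with V assms(1) show ?thesis
    unfolding has_mat_derivative_def
    by (auto intro!: bounded_linear.has_vector_derivative[OF bounded_linear_cnj])
qed

section \<open>Differential equations on the unitary group\<close>

text \<open>Turns a matrix into a point of a Banach space whose norm is the largest modulus of an
  entry; index pairs out of range get the value 0.\<close>

definition mat_bcontfun :: "nat \<Rightarrow> complex mat \<Rightarrow> (nat \<times> nat) discrete \<Rightarrow>\<^sub>C complex" where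
  "mat_bcontfun n A = Bcontfun (\<lambda>q. case of_discrete q of (i, j) \<Rightarrow> if i < n \<and> j < n then A $$ (i, j) else 0)"

lemma apply_mat_bcontfun:
  "apply_bcontfun (mat_bcontfun n A) (discrete p) = (if fst p < n \<and> snd p < n then A $$ p else 0)"
proof -
  define f where "f q = (case of_discrete q of (i, j) \<Rightarrow> if i < n \<and> j < n then A $$ (i, j) else 0)"
    for q :: "(nat \<times> nat) discrete"
  have "f \<in> bcontfun"
  proof (rule bcontfun_normI)
    show "continuous_on UNIV f"
      by (simp add: continuous_on_open_vimage Discrete_Topology.open_discrete)
    fix q :: "(nat \<times> nat) discrete"
    obtain i j where q: "of_discrete q = (i, j)" by (cases "of_discrete q")
    have "norm (A $$ (i, j)) \<le> (\<Sum>p\<in>{..<n} \<times> {..<n}. norm (A $$ p))" if "i < n" "j < n"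
      using that by (intro member_le_sum[of "(i, j)"]) auto
    then show "norm (f q) \<le> (\<Sum>p\<in>{..<n} \<times> {..<n}. norm (A $$ p))"
      by (auto simp: f_def q intro: sum_nonneg)
  qed
  then show ?thesis
    by (simp add: mat_bcontfun_def f_def[abs_def] Bcontfun_inverse discrete_inverse case_prod_unfold)
qed

lemma mat_bcontfun_norm_bound:
  assumes "\<And>p. norm (apply_bcontfun f (discrete p)) \<le> b"
  shows "norm f \<le> b"
  using assms by (intro norm_bound) (metis of_discrete_inverse)

lemma bounded_linear_apply_bcontfun:
  fixes p :: "'a::topological_space"
  shows "bounded_linear (\<lambda>f :: 'a \<Rightarrow>\<^sub>C 'b::real_normed_vector. apply_bcontfun f p)"
  by (rule bounded_linear_intro[where K = 1]) (auto simp: norm_bounded)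

lemma bdd_lipschitz_mat_bcontfun:
  assumes "mat_bdd_lipschitz n f"
  shows "bdd_lipschitz (\<lambda>x. mat_bcontfun n (f x))"
proof -
  have "\<exists>K. \<forall>x y. norm (f x $$ p) \<le> K \<and> norm (f x $$ p - f y $$ p) \<le> K * norm (x - y)"
    if "p \<in> {..<n} \<times> {..<n}" for p
    using assms that unfolding mat_bdd_lipschitz_def bdd_lipschitz_def by auto
  then obtain K where K: "norm (f x $$ p) \<le> K p" "norm (f x $$ p - f y $$ p) \<le> K p * norm (x - y)"
    if "p \<in> {..<n} \<times> {..<n}" for p x y
    by metis
  define M where "M = (\<Sum>p\<in>{..<n} \<times> {..<n}. K p)"
  have K0: "0 \<le> K p" if "p \<in> {..<n} \<times> {..<n}" for p
    using K(1)[OF that] norm_ge_zero order_trans by blast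
  have KM: "K p \<le> M" if "p \<in> {..<n} \<times> {..<n}" for p
    unfolding M_def using that K0 by (intro member_le_sum) auto
  have "M \<ge> 0" unfolding M_def using K0 by (intro sum_nonneg) auto
  show ?thesis
  proof (rule bdd_lipschitzI)
    fix x y
    show "norm (mat_bcontfun n (f x)) \<le> M"
    proof (rule mat_bcontfun_norm_bound)
      fix p :: "nat \<times> nat"
      show "norm (apply_bcontfun (mat_bcontfun n (f x)) (discrete p)) \<le> M"
        using order_trans[OF K(1) KM, of p x] \<open>M \<ge> 0\<close>
        by (auto simp: apply_mat_bcontfun mem_Times_iff)
    qed
    show "norm (mat_bcontfun n (f x) - mat_bcontfun n (f y)) \<le> M * norm (x - y)"
    proof (rule mat_bcontfun_norm_bound)
      fix p :: "nat \<times> nat"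
      show "norm (apply_bcontfun (mat_bcontfun n (f x) - mat_bcontfun n (f y)) (discrete p)) \<le> M * norm (x - y)"
      proof (cases "p \<in> {..<n} \<times> {..<n}")
        case True
        with K(2)[OF True, of x y] mult_right_mono[OF KM[OF True], of "norm (x - y)"] show ?thesis
          by (auto simp: apply_mat_bcontfun mem_Times_iff)
      qed (use \<open>M \<ge> 0\<close> in \<open>auto simp: apply_mat_bcontfun mem_Times_iff\<close>)
    qed
  qed
qed

lemma has_vector_derivative_zero_imp_zero:
  fixes G :: "real \<Rightarrow> 'a::real_normed_vector"
  assumes "\<And>t. (G has_vector_derivative 0) (at t)" "G 0 = 0"
  shows "G t = 0"
  using antiderivative_norm_bound[of G "\<lambda>_. 0" "\<lambda>_. 0" "\<lambda>_. 0" t] assms by simp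

text \<open>Rows of a unitary matrix are unit vectors. In the supremum norm of entries this places
  unitary matrices in the unit ball, where the radial retraction is the identity.\<close>

lemma unitary_group_entry_le_1:
  assumes "g \<in> unitary_group n" "i < n" "j < n"
  shows "cmod (g $$ (i, j)) \<le> 1"
proof -
  have g: "g \<in> carrier_mat n n" "mat_adjoint g \<in> carrier_mat n n" and gg: "g * mat_adjoint g = 1\<^sub>m n"
    using assms by (auto simp: unitary_group_def)
  have "(\<Sum>l<n. g $$ (i, l) * mat_adjoint g $$ (l, i)) = 1"
    using index_mult_mat_sum[OF g assms(2,2)] gg assms by simp
  then have "complex_of_real (\<Sum>l<n. (cmod (g $$ (i, l)))\<^sup>2) = 1"
    using g assms by (simp add: complex_norm_square del: of_real_power)
  then have "(\<Sum>l<n. (cmod (g $$ (i, l)))\<^sup>2) = 1"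
    using of_real_eq_1_iff by blast
  moreover have "(cmod (g $$ (i, j)))\<^sup>2 \<le> (\<Sum>l<n. (cmod (g $$ (i, l)))\<^sup>2)"
    using assms by (intro member_le_sum) auto
  ultimately show ?thesis
    by (simp add: power2_le_iff_abs_le abs_square_le_1)
qed

text \<open>
  The vector field is made bounded and Lipschitz by retracting its argument radially to the unit
  ball. A radial retraction only rescales g, so g' = c g K with a real scalar c and a
  skew-Hermitian K, which keeps g unitary, and the retraction is never active along the solution.
\<close>

theorem unitary_ode_solution:
  fixes K :: "complex mat \<Rightarrow> complex mat" and S :: "(nat \<times> nat) set"
  assumes g0: "g0 \<in> unitary_group n"
    and K: "\<And>y. y \<in> carrier_mat n n \<Longrightarrow> K y \<in> skew_hermitian n"
    and lip: "\<And>f :: ((nat \<times> nat) discrete \<Rightarrow>\<^sub>C complex) \<Rightarrow> complex mat.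
      mat_bdd_lipschitz n f \<Longrightarrow> mat_bdd_lipschitz n (\<lambda>x. K (f x))"
    and supp0: "\<And>i j. i < n \<Longrightarrow> j < n \<Longrightarrow> (i, j) \<notin> S \<Longrightarrow> g0 $$ (i, j) = 0"
    and supp: "\<And>y i j. y \<in> carrier_mat n n \<Longrightarrow>
      (\<And>i j. i < n \<Longrightarrow> j < n \<Longrightarrow> (i, j) \<notin> S \<Longrightarrow> y $$ (i, j) = 0) \<Longrightarrow>
      i < n \<Longrightarrow> j < n \<Longrightarrow> (i, j) \<notin> S \<Longrightarrow> (y * K y) $$ (i, j) = 0"
  obtains g where "g 0 = g0" "\<And>t. g t \<in> unitary_group n"
    "\<And>t. has_mat_derivative n g (g t * K (g t)) t"
    "\<And>t i j. i < n \<Longrightarrow> j < n \<Longrightarrow> (i, j) \<notin> S \<Longrightarrow> g t $$ (i, j) = 0"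
proof -
  define r where "r x = x /\<^sub>R max 1 (norm x)" for x :: "(nat \<times> nat) discrete \<Rightarrow>\<^sub>C complex"
  \<comment> \<open>The retracted point is also projected to the support \<open>S\<close>, so that
    \<open>supp\<close> applies at every argument of the field, not only along the solution.\<close>
  define Y where "Y x = mat n n (\<lambda>p. if p \<in> S then apply_bcontfun (r x) (discrete p) else 0)" for x
  have Y_carrier: "Y x \<in> carrier_mat n n" for x
    by (simp add: Y_def)
  have "mat_bdd_lipschitz n Y"
    unfolding mat_bdd_lipschitz_def
  proof (intro conjI allI impI)
    fix i j assume ij: "i < n" "j < n"
    obtain C where C: "C \<ge> 0" "\<And>x. norm (r x) \<le> C" "\<And>x y. norm (r x - r y) \<le> C * norm (x - y)"
      using bdd_lipschitz_radial_retraction unfolding r_def by (rule bdd_lipschitzE) blast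
    show "bdd_lipschitz (\<lambda>x. Y x $$ (i, j))"
    proof (rule bdd_lipschitzI[where B = C and K = C])
      show "norm (Y x $$ (i, j)) \<le> C" for x
        using C(1) order_trans[OF norm_bounded C(2)] ij by (simp add: Y_def)
      show "norm (Y x $$ (i, j) - Y y $$ (i, j)) \<le> C * norm (x - y)" for x y
        using C(1) order_trans[OF norm_bounded[of "r x - r y"] C(3)] ij by (simp add: Y_def)
    qed
  qed (rule Y_carrier)
  \<comment> \<open>The hypothesis \<open>lip\<close> only asks that \<open>K\<close> preserve
    bounded Lipschitz families. This admits fields that are polynomial in the entries and their
    conjugates; the retraction supplies such a family.\<close>
  then have "mat_bdd_lipschitz n (\<lambda>x. Y x * K (Y x))"
    by (intro mat_bdd_lipschitz_mult lip)
  then have "bdd_lipschitz (\<lambda>x. mat_bcontfun n (Y x * K (Y x)))"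
    by (rule bdd_lipschitz_mat_bcontfun)
  then obtain C where "\<And>x. norm (mat_bcontfun n (Y x * K (Y x))) \<le> C"
    "\<And>x y. norm (mat_bcontfun n (Y x * K (Y x)) - mat_bcontfun n (Y y * K (Y y))) \<le> C * norm (x - y)"
    by (rule bdd_lipschitzE) blast
  then obtain x where x0: "x 0 = mat_bcontfun n g0"
    and x: "\<And>t. (x has_vector_derivative mat_bcontfun n (Y (x t) * K (Y (x t)))) (at t)"
    by (rule picard_lindeloef_bounded[where F = "\<lambda>x. mat_bcontfun n (Y x * K (Y x))" and init = "mat_bcontfun n g0"])
      blast
  have x_entry: "((\<lambda>s. apply_bcontfun (x s) (discrete p)) has_vector_derivative
      apply_bcontfun (mat_bcontfun n (Y (x t) * K (Y (x t)))) (discrete p)) (at t)" for p t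
    by (rule bounded_linear.has_vector_derivative[OF bounded_linear_apply_bcontfun x])
  \<comment> \<open>The field never points out of the matrices supported in \<open>S\<close>, so the
    solution itself, and not only its projection, keeps this support.\<close>
  have x_zero: "apply_bcontfun (x t) (discrete p) = 0" if "\<not> (fst p < n \<and> snd p < n \<and> p \<in> S)" for p t
  proof (rule has_vector_derivative_zero_imp_zero)
    show "apply_bcontfun (x 0) (discrete p) = 0"
      using supp0[of "fst p" "snd p"] that by (simp add: x0 apply_mat_bcontfun)
    fix s
    have "apply_bcontfun (mat_bcontfun n (Y (x s) * K (Y (x s)))) (discrete p) = 0"
      using supp[OF Y_carrier, of "x s" "fst p" "snd p"] that
      by (auto simp: apply_mat_bcontfun Y_def)
    with x_entry[of p s] show "((\<lambda>s. apply_bcontfun (x s) (discrete p)) has_vector_derivative 0) (at s)"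
      by simp
  qed
  define g where "g t = mat n n (\<lambda>p. apply_bcontfun (x t) (discrete p))" for t
  define c where "c t = complex_of_real (1 / max 1 (norm (x t)))" for t
  have g: "g t \<in> carrier_mat n n" for t
    by (simp add: g_def)
  have Y_eq: "Y (x t) = c t \<cdot>\<^sub>m g t" for t
    by (rule eq_matI) (auto simp: Y_def g_def c_def r_def x_zero scaleR_conv_of_real divide_inverse)
  have KY: "K (Y (x t)) \<in> carrier_mat n n" "mat_adjoint (K (Y (x t))) = - K (Y (x t))" for t
    using K[OF Y_carrier, of "x t"] by (auto simp: skew_hermitian_def)
  have g': "has_mat_derivative n g (Y (x t) * K (Y (x t))) t" for t
    unfolding has_mat_derivative_def
  proof (intro conjI allI impI)
    show "Y (x t) * K (Y (x t)) \<in> carrier_mat n n"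
      using Y_carrier KY by (intro mult_carrier_mat)
    fix i j assume "i < n" "j < n"
    with x_entry[of "(i, j)" t]
    show "((\<lambda>s. g s $$ (i, j)) has_vector_derivative (Y (x t) * K (Y (x t))) $$ (i, j)) (at t)"
      by (simp add: g_def apply_mat_bcontfun)
  qed
  have g_0: "g 0 = g0"
    using g0 by (intro eq_matI) (auto simp: g_def x0 apply_mat_bcontfun unitary_group_def)
  have unitary: "g t \<in> unitary_group n" for t
  proof -
    have deriv0: "has_mat_derivative n (\<lambda>s. g s * mat_adjoint (g s)) (0\<^sub>m n n) s" for s
    proof -
      define G H k where "G = g s" and "H = mat_adjoint (g s)" and "k = K (Y (x s))"
      have carrier: "G \<in> carrier_mat n n" "H \<in> carrier_mat n n" "k \<in> carrier_mat n n"
        using g KY by (simp_all add: G_def H_def k_def)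
      define P where "P = G * (k * H)"
      have P: "P \<in> carrier_mat n n"
        using carrier by (simp add: P_def)
      have Yk: "Y (x s) * k = c s \<cdot>\<^sub>m (G * k)"
        unfolding Y_eq G_def[symmetric] by (rule mult_smult_assoc_mat[OF carrier(1,3)])
      have "mat_adjoint (Y (x s) * k) = c s \<cdot>\<^sub>m (mat_adjoint k * H)"
        unfolding Yk mat_adjoint_smult mat_adjoint_mult[OF carrier(1,3)] by (simp add: c_def H_def G_def)
      also have "mat_adjoint k * H = - (k * H)"
        using carrier KY(2)[of s] by (simp add: k_def)
      finally have "G * mat_adjoint (Y (x s) * k) = c s \<cdot>\<^sub>m (G * - (k * H))"
        using carrier by (simp only: mult_smult_distrib[of _ n n _ n] uminus_carrier_mat mult_carrier_mat[of _ n n])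
      also have "G * - (k * H) = - P"
        unfolding P_def using carrier by (intro uminus_mult_right_mat) auto
      finally have 1: "G * mat_adjoint (Y (x s) * k) = c s \<cdot>\<^sub>m (- P)" .
      have "Y (x s) * k * H = c s \<cdot>\<^sub>m (G * k * H)"
        unfolding Yk using carrier by (intro mult_smult_assoc_mat[of _ n n _ n]) auto
      then have 2: "Y (x s) * k * H = c s \<cdot>\<^sub>m P"
        unfolding P_def using carrier by (simp add: assoc_mult_mat[of _ n n _ n _ n])
      have "G * mat_adjoint (Y (x s) * k) + Y (x s) * k * H = 0\<^sub>m n n"
        unfolding 1 2 using P by (intro eq_matI) auto
      then show ?thesis
        using has_mat_derivative_mult[OF g'[of s] has_mat_derivative_adjoint[OF g'[of s] g] g] g
        by (simp add: G_def H_def k_def)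
    qed
    have "(g t * mat_adjoint (g t)) $$ (i, j) - 1\<^sub>m n $$ (i, j) = 0" if ij: "i < n" "j < n" for i j
    proof (rule has_vector_derivative_zero_imp_zero)
      show "(g 0 * mat_adjoint (g 0)) $$ (i, j) - 1\<^sub>m n $$ (i, j) = 0"
        using g0 by (simp add: g_0 unitary_group_def)
      show "((\<lambda>s. (g s * mat_adjoint (g s)) $$ (i, j) - 1\<^sub>m n $$ (i, j)) has_vector_derivative 0) (at s)" for s
        using has_mat_derivative_index[OF deriv0 ij, of s] ij by (auto intro!: derivative_eq_intros)
    qed
    then have "g t * mat_adjoint (g t) = 1\<^sub>m n"
      using g[of t] by (intro eq_matI) auto
    with g[of t] show ?thesis
      by (simp add: unitary_group_def)
  qed
  have "norm (x t) \<le> 1" for t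
  proof (rule mat_bcontfun_norm_bound)
    fix p
    show "norm (apply_bcontfun (x t) (discrete p)) \<le> 1"
    proof (cases "fst p < n \<and> snd p < n")
      case True
      with unitary_group_entry_le_1[OF unitary, of "fst p" "snd p" t] show ?thesis
        by (cases p) (simp add: g_def)
    qed (auto simp: x_zero)
  qed
  then have "c t = 1" for t
    by (simp add: c_def max_absorb1)
  then have "Y (x t) = g t" for t
    using g[of t] by (intro eq_matI) (auto simp: Y_eq)
  with g' have "has_mat_derivative n g (g t * K (g t)) t" for t
    by metis
  with g_0 unitary show thesis
    by (rule that) (auto simp: g_def x_zero)
qed

section \<open>Adjoint orbits and their normal metric\<close>

lemma mat_trace_comm:
  assumes "A \<in> carrier_mat n m" "B \<in> carrier_mat m n"
  shows "mat_trace (A * B) = mat_trace (B * A)"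
proof -
  have "mat_trace (A * B) = (\<Sum>i<n. \<Sum>l<m. A $$ (i, l) * B $$ (l, i))"
    using assms by (simp add: mat_trace_def index_mult_mat_sum[OF assms] del: index_mult_mat(1))
  also have "\<dots> = (\<Sum>l<m. \<Sum>i<n. B $$ (l, i) * A $$ (i, l))"
    by (subst sum.swap) (simp add: mult.commute)
  also have "\<dots> = mat_trace (B * A)"
    using assms by (simp add: mat_trace_def index_mult_mat_sum[OF assms(2,1)] del: index_mult_mat(1))
  finally show ?thesis .
qed

lemma mat_trace_minus:
  assumes "A \<in> carrier_mat n n" "B \<in> carrier_mat n n"
  shows "mat_trace (A - B) = mat_trace A - mat_trace B"
  using assms by (auto simp: mat_trace_def sum_subtractf)

lemma mat_trace_smult: "A \<in> carrier_mat n n \<Longrightarrow> mat_trace (c \<cdot>\<^sub>m A) = c * mat_trace A"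
  by (auto simp: mat_trace_def sum_distrib_left)

lemma ad_carrier [simp]: "L \<in> carrier_mat n n \<Longrightarrow> X \<in> carrier_mat n n \<Longrightarrow> ad L X \<in> carrier_mat n n"
  unfolding ad_def by (intro minus_carrier_mat mult_carrier_mat)

lemma mat_trace_ad [simp]:
  assumes "L \<in> carrier_mat n n" "X \<in> carrier_mat n n"
  shows "mat_trace (ad L X) = 0"
  using assms mat_trace_comm[OF assms]
  by (simp add: ad_def mat_trace_minus[of _ n] mult_carrier_mat[of _ n n])

text \<open>Cyclicity of the trace. This antisymmetry makes image and kernel of \<open>ad L\<close>
  orthogonal, and later moves the commutator from \<open>N\<close> to the tangent vector.\<close>

lemma mat_trace_ad_mult:
  assumes "L \<in> carrier_mat n n" "X \<in> carrier_mat n n" "B \<in> carrier_mat n n"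
  shows "mat_trace (ad L X * B) = - mat_trace (X * ad L B)"
proof -
  have c: "L * X \<in> carrier_mat n n" "X * L \<in> carrier_mat n n" "L * B \<in> carrier_mat n n"
    "B * L \<in> carrier_mat n n" "X * B \<in> carrier_mat n n"
    using assms by auto
  have "mat_trace (ad L X * B) = mat_trace (L * X * B) - mat_trace (X * L * B)"
    using assms c unfolding ad_def
    by (subst minus_mult_distrib_mat[of _ n n _ _ n]) (auto simp: mat_trace_minus[of _ n] mult_carrier_mat[of _ n n])
  also have "L * X * B = L * (X * B)"
    using assms by simp
  also have "mat_trace (L * (X * B)) = mat_trace (X * B * L)"
    using assms c by (intro mat_trace_comm)
  also have "X * B * L = X * (B * L)"
    using assms by simp
  also have "X * L * B = X * (L * B)"
    using assms by simp
  also have "mat_trace (X * (B * L)) - mat_trace (X * (L * B)) = - (mat_trace (X * (L * B)) - mat_trace (X * (B * L)))"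
    by simp
  also have "mat_trace (X * (L * B)) - mat_trace (X * (B * L)) = mat_trace (X * ad L B)"
    using assms c unfolding ad_def
    by (subst mult_minus_distrib_mat[of _ n n _ n]) (auto simp: mat_trace_minus[of _ n] mult_carrier_mat[of _ n n])
  finally show ?thesis .
qed

lemma ad_minus:
  assumes "L \<in> carrier_mat n n" "X \<in> carrier_mat n n" "Y \<in> carrier_mat n n"
  shows "ad L (X - Y) = ad L X - ad L Y"
proof -
  have c: "L * X \<in> carrier_mat n n" "X * L \<in> carrier_mat n n" "L * Y \<in> carrier_mat n n" "Y * L \<in> carrier_mat n n"
    using assms by auto
  show ?thesis
    unfolding ad_def mult_minus_distrib_mat[OF assms] minus_mult_distrib_mat[OF assms(2,3,1)]
    by (rule eq_matI) (simp_all add: carrier_matD[OF c(1)] carrier_matD[OF c(2)] carrier_matD[OF c(3)]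
        carrier_matD[OF c(4)] carrier_matD[OF assms(1)] carrier_matD[OF assms(2)] carrier_matD[OF assms(3)]
        del: index_mult_mat)
qed

lemma ad_smult:
  assumes "L \<in> carrier_mat n n" "X \<in> carrier_mat n n"
  shows "ad L (c \<cdot>\<^sub>m X) = c \<cdot>\<^sub>m ad L X"
proof -
  have c: "L * X \<in> carrier_mat n n" "X * L \<in> carrier_mat n n"
    using assms by auto
  show ?thesis
    unfolding ad_def mult_smult_distrib[OF assms] mult_smult_assoc_mat[OF assms(2,1)]
    by (rule eq_matI) (simp_all add: carrier_matD[OF c(1)] carrier_matD[OF c(2)] right_diff_distrib
        del: index_mult_mat)
qed

section \<open>Skew-Hermitian matrices and the decomposition into image and kernel\<close>

lemma skew_hermitian_carrier: "X \<in> skew_hermitian n \<Longrightarrow> X \<in> carrier_mat n n"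
  by (simp add: skew_hermitian_def)

lemma skew_hermitian_index:
  assumes "X \<in> skew_hermitian n" "i < n" "j < n"
  shows "X $$ (j, i) = - cnj (X $$ (i, j))"
proof -
  have "mat_adjoint X $$ (j, i) = (- X) $$ (j, i)"
    using assms by (simp add: skew_hermitian_def)
  then show ?thesis
    using skew_hermitian_carrier[OF assms(1)] assms(2,3) by (auto simp: minus_equation_iff)
qed

lemma skew_hermitianI:
  assumes "X \<in> carrier_mat n n" "\<And>i j. i < n \<Longrightarrow> j < n \<Longrightarrow> X $$ (j, i) = - cnj (X $$ (i, j))"
  shows "X \<in> skew_hermitian n"
proof -
  have "cnj (X $$ (j, i)) = - (X $$ (i, j))" if "i < n" "j < n" for i j
    by (simp add: assms(2)[OF that(2,1)])
  then have "mat_adjoint X = - X"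
    using assms(1) by (intro eq_matI) auto
  with assms(1) show ?thesis by (simp add: skew_hermitian_def)
qed

lemma skew_hermitian_minus:
  assumes "X \<in> skew_hermitian n" "Y \<in> skew_hermitian n"
  shows "X - Y \<in> skew_hermitian n"
proof (rule skew_hermitianI)
  note c = assms[THEN skew_hermitian_carrier]
  show "X - Y \<in> carrier_mat n n"
    using c by (intro minus_carrier_mat)
  show "(X - Y) $$ (j, i) = - cnj ((X - Y) $$ (i, j))" if "i < n" "j < n" for i j
    using c that skew_hermitian_index[OF assms(1) that] skew_hermitian_index[OF assms(2) that]
    by (simp add: carrier_matD[OF c(1)] carrier_matD[OF c(2)])
qed

lemma skew_hermitian_smult_real:
  assumes "X \<in> skew_hermitian n"
  shows "complex_of_real c \<cdot>\<^sub>m X \<in> skew_hermitian n"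
proof (rule skew_hermitianI)
  note c = skew_hermitian_carrier[OF assms]
  then show "complex_of_real c \<cdot>\<^sub>m X \<in> carrier_mat n n"
    by simp
  show "(complex_of_real c \<cdot>\<^sub>m X) $$ (j, i) = - cnj ((complex_of_real c \<cdot>\<^sub>m X) $$ (i, j))"
    if "i < n" "j < n" for i j
    using that skew_hermitian_index[OF assms that] by (simp add: carrier_matD[OF c])
qed

lemma skew_hermitian_ad:
  assumes "L \<in> skew_hermitian n" "X \<in> skew_hermitian n"
  shows "ad L X \<in> skew_hermitian n"
proof -
  note c = assms[THEN skew_hermitian_carrier]
  have adj: "mat_adjoint L = - L" "mat_adjoint X = - X"
    using assms by (simp_all add: skew_hermitian_def)
  have "mat_adjoint (ad L X) = mat_adjoint (L * X) - mat_adjoint (X * L)"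
    unfolding ad_def using c by (intro mat_adjoint_minus) auto
  also have "\<dots> = - X * - L - - L * - X"
    by (simp only: mat_adjoint_mult[OF c] mat_adjoint_mult[OF c(2,1)] adj)
  also have "\<dots> = - ad L X"
    unfolding ad_def using c by (intro eq_matI) auto
  finally show ?thesis
    using c by (simp add: skew_hermitian_def)
qed

lemma skew_hermitian_congruence:
  assumes "X \<in> skew_hermitian n" "g \<in> carrier_mat n n"
  shows "g * X * mat_adjoint g \<in> skew_hermitian n"
proof -
  note c = assms(1)[THEN skew_hermitian_carrier] assms(2)
  have adj: "mat_adjoint X = - X"
    using assms by (simp add: skew_hermitian_def)
  have "mat_adjoint (g * X * mat_adjoint g) = g * mat_adjoint (g * X)"
    using c by (subst mat_adjoint_mult[of _ n n _ n]) auto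
  also have "\<dots> = g * (- X * mat_adjoint g)"
    using c adj by (subst mat_adjoint_mult[of _ n n _ n]) auto
  also have "\<dots> = - (g * X * mat_adjoint g)"
    using c by (simp add: assoc_mult_mat[of _ n n _ n _ n] mult_carrier_mat[of _ n n])
  moreover have "g * X * mat_adjoint g \<in> carrier_mat n n"
    using c by (intro mult_carrier_mat[of _ n n]) auto
  ultimately show ?thesis
    by (simp add: skew_hermitian_def)
qed

text \<open>The trace of the square is minus the sum of all squared moduli of entries, so the trace
  form is definite on skew-Hermitian matrices.\<close>

lemma skew_hermitian_trace_square_eq_0:
  assumes "A \<in> skew_hermitian n" "mat_trace (A * A) = 0"
  shows "A = 0\<^sub>m n n"
proof -
  note c = skew_hermitian_carrier[OF assms(1)]
  have "mat_trace (A * A) = (\<Sum>i<n. \<Sum>l<n. A $$ (i, l) * A $$ (l, i))"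
    using c by (simp add: mat_trace_def index_mult_mat_sum[OF c c] del: index_mult_mat(1))
  also have "\<dots> = (\<Sum>i<n. \<Sum>l<n. - complex_of_real ((cmod (A $$ (i, l)))\<^sup>2))"
  proof (intro sum.cong refl)
    fix i l assume il: "i \<in> {..<n}" "l \<in> {..<n}"
    then have "A $$ (l, i) = - cnj (A $$ (i, l))"
      by (intro skew_hermitian_index[OF assms(1)]) auto
    then show "A $$ (i, l) * A $$ (l, i) = - complex_of_real ((cmod (A $$ (i, l)))\<^sup>2)"
      unfolding complex_norm_square by simp
  qed
  also have "\<dots> = - complex_of_real (\<Sum>i<n. \<Sum>l<n. (cmod (A $$ (i, l)))\<^sup>2)"
    by (simp only: sum_negf of_real_sum)
  finally have "- complex_of_real (\<Sum>i<n. \<Sum>l<n. (cmod (A $$ (i, l)))\<^sup>2) = 0"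
    by (simp only: assms(2))
  then have "complex_of_real (\<Sum>i<n. \<Sum>l<n. (cmod (A $$ (i, l)))\<^sup>2) = 0"
    by (rule neg_equal_0_iff_equal[THEN iffD1])
  then have 0: "(\<Sum>i<n. \<Sum>l<n. (cmod (A $$ (i, l)))\<^sup>2) = 0"
    by (rule of_real_eq_0_iff[THEN iffD1])
  have "A $$ (i, l) = 0" if il: "i < n" "l < n" for i l
  proof -
    have "(\<Sum>l<n. (cmod (A $$ (i, l)))\<^sup>2) = 0"
      by (rule sum_nonneg_0[OF _ _ 0]) (use il in \<open>simp_all add: sum_nonneg\<close>)
    then have "(cmod (A $$ (i, l)))\<^sup>2 = 0"
      by (rule sum_nonneg_0[rotated 2]) (use il in simp_all)
    then show ?thesis by simp
  qed
  then show ?thesis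
    using c by (intro eq_matI) auto
qed

text \<open>If A = [L,X], antisymmetry of the commutator gives tr(AA) = -tr(X [L,A]) = 0, and the
  trace form is definite.\<close>

lemma ad_image_Int_kernel:
  assumes L: "L \<in> skew_hermitian n" and A: "A \<in> ad_image n L" and ker: "ad L A = 0\<^sub>m n n"
  shows "A = 0\<^sub>m n n"
proof -
  obtain X where X: "X \<in> skew_hermitian n" "A = ad L X"
    using A by (auto simp: ad_image_def)
  note c = L[THEN skew_hermitian_carrier] X(1)[THEN skew_hermitian_carrier]
  have "mat_trace (A * A) = - mat_trace (X * ad L A)"
    using mat_trace_ad_mult[OF c, of A] c X by simp
  also have "\<dots> = 0"
    using c ker by (simp add: mat_trace_def)
  finally show ?thesis
    using skew_hermitian_trace_square_eq_0 skew_hermitian_ad L X by blast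
qed

text \<open>Two candidates differ by an element of both the image and the kernel, hence by 0. This
  is what evaluates the definite description in \<open>im_part\<close>.\<close>

lemma im_part_eqI:
  assumes L: "L \<in> skew_hermitian n" and X: "X \<in> carrier_mat n n"
    and A: "A \<in> ad_image n L" "X - A \<in> ad_kernel n L"
  shows "im_part n L X = A"
  unfolding im_part_def
proof (rule the_equality)
  fix B assume B: "B \<in> ad_image n L \<and> X - B \<in> ad_kernel n L"
  obtain Y Z where YZ: "Y \<in> skew_hermitian n" "A = ad L Y" "Z \<in> skew_hermitian n" "B = ad L Z"
    using A(1) B by (auto simp: ad_image_def)
  note c = L[THEN skew_hermitian_carrier] YZ(1)[THEN skew_hermitian_carrier] YZ(3)[THEN skew_hermitian_carrier] X
  have cAB: "A \<in> carrier_mat n n" "B \<in> carrier_mat n n"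
    using c YZ by auto
  have "B - A = ad L (Z - Y)"
    using c YZ by (simp add: ad_minus)
  then have im: "B - A \<in> ad_image n L"
    using skew_hermitian_minus YZ by (auto simp: ad_image_def)
  have "B - A = (X - A) - (X - B)"
    using cAB X by (intro eq_matI) auto
  moreover have "ad L (X - A - (X - B)) = ad L (X - A) - ad L (X - B)"
    using c cAB by (intro ad_minus[of _ n] minus_carrier_mat)
  ultimately have "ad L (B - A) = 0\<^sub>m n n"
    using A(2) B by (simp add: ad_kernel_def)
  then have *: "B - A = 0\<^sub>m n n"
    by (rule ad_image_Int_kernel[OF L im])
  have "B $$ (i, j) = A $$ (i, j)" if "i < n" "j < n" for i j
    using arg_cong[OF *, of "\<lambda>M. M $$ (i, j)"] that cAB by auto
  then show "B = A"
    using cAB by (intro eq_matI) auto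
qed (use A in simp)

section \<open>Conjugation by unitary matrices\<close>

lemma unitary_group_carrier: "g \<in> unitary_group n \<Longrightarrow> g \<in> carrier_mat n n"
  by (simp add: unitary_group_def)

lemma unitary_groupD:
  assumes "g \<in> unitary_group n"
  shows "g * mat_adjoint g = 1\<^sub>m n" "mat_adjoint g * g = 1\<^sub>m n"
proof -
  show *: "g * mat_adjoint g = 1\<^sub>m n"
    using assms by (simp add: unitary_group_def)
  show "mat_adjoint g * g = 1\<^sub>m n"
    using unitary_group_carrier[OF assms] * by (intro mat_mult_left_right_inverse[of g n]) auto
qed

lemma unitary_conj_mult:
  assumes "g \<in> unitary_group n" "A \<in> carrier_mat n n" "B \<in> carrier_mat n n"
  shows "g * A * mat_adjoint g * (g * B * mat_adjoint g) = g * (A * B) * mat_adjoint g"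
proof -
  note c = unitary_group_carrier[OF assms(1)] assms(2,3)
  have "g * A * mat_adjoint g * (g * B * mat_adjoint g) = g * A * ((mat_adjoint g * g) * (B * mat_adjoint g))"
    using c by (simp add: assoc_mult_mat[of _ n n _ n _ n] mult_carrier_mat[of _ n n])
  also have "\<dots> = g * (A * B) * mat_adjoint g"
    using c unfolding unitary_groupD(2)[OF assms(1)]
    by (simp add: assoc_mult_mat[of _ n n _ n _ n] mult_carrier_mat[of _ n n] left_mult_one_mat[of _ n n])
  finally show ?thesis .
qed

lemma congruence_minus:
  assumes "g \<in> carrier_mat n n" "A \<in> carrier_mat n n" "B \<in> carrier_mat n n"
  shows "g * (A - B) * mat_adjoint g = g * A * mat_adjoint g - g * B * (mat_adjoint g :: complex mat)"
  unfolding mult_minus_distrib_mat[OF assms]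
  using assms by (intro minus_mult_distrib_mat[of _ n n]) auto

lemma unitary_conj_ad:
  assumes "g \<in> unitary_group n" "A \<in> carrier_mat n n" "B \<in> carrier_mat n n"
  shows "ad (g * A * mat_adjoint g) (g * B * mat_adjoint g) = g * ad A B * mat_adjoint g"
proof -
  have "A * B \<in> carrier_mat n n" "B * A \<in> carrier_mat n n"
    using assms by auto
  then show ?thesis
    unfolding ad_def unitary_conj_mult[OF assms] unitary_conj_mult[OF assms(1,3,2)]
    by (rule congruence_minus[OF unitary_group_carrier[OF assms(1)], symmetric])
qed

lemma unitary_conj_inverse:
  assumes "g \<in> unitary_group n" "X \<in> carrier_mat n n"
  shows "g * (mat_adjoint g * X * g) * mat_adjoint g = X"
proof -
  note c = unitary_group_carrier[OF assms(1)] assms(2)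
  have "g * (mat_adjoint g * X * g) * mat_adjoint g = (g * mat_adjoint g) * X * (g * mat_adjoint g)"
    using c by (simp add: assoc_mult_mat[of _ n n _ n _ n] mult_carrier_mat[of _ n n])
  with c show ?thesis
    by (simp add: unitary_groupD(1)[OF assms(1)] left_mult_one_mat[of _ n n] right_mult_one_mat[of _ n n])
qed

definition eigen_mat :: "nat \<Rightarrow> (nat \<Rightarrow> real) \<Rightarrow> complex mat" where
  "eigen_mat n lam = \<i> \<cdot>\<^sub>m mat_diag n (\<lambda>i. complex_of_real (lam i))"

lemma eigen_mat_carrier [simp]: "eigen_mat n lam \<in> carrier_mat n n"
  by (simp add: eigen_mat_def)

lemma eigen_mat_index [simp]:
  "i < n \<Longrightarrow> j < n \<Longrightarrow> eigen_mat n lam $$ (i, j) = (if i = j then \<i> * lam i else 0)"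
  by (simp add: eigen_mat_def mat_diag_def)

lemma conj_diag_eq: "conj_diag n lam g = g * eigen_mat n lam * mat_adjoint g"
  by (simp add: conj_diag_def eigen_mat_def)

lemma eigen_mat_skew: "eigen_mat n lam \<in> skew_hermitian n"
  by (rule skew_hermitianI) auto

lemma adj_orbit_skew: "L \<in> adj_orbit n lam \<Longrightarrow> L \<in> skew_hermitian n"
  by (auto simp: adj_orbit_def conj_diag_eq intro!: skew_hermitian_congruence eigen_mat_skew unitary_group_carrier)

text \<open>Elementary matrices are eigenvectors of the commutator with a diagonal matrix. For
  distinct eigenvalues it is therefore invertible off the diagonal and zero on it.\<close>

lemma ad_eigen_mat_index:
  assumes "X \<in> carrier_mat n n" "i < n" "j < n"
  shows "ad (eigen_mat n lam) X $$ (i, j) = \<i> * (lam i - lam j) * X $$ (i, j)"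
proof -
  have "(eigen_mat n lam * X) $$ (i, j) = (\<Sum>l<n. if l = i then \<i> * lam i * X $$ (i, j) else 0)"
    unfolding index_mult_mat_sum[OF eigen_mat_carrier assms] using assms by (intro sum.cong) auto
  moreover have "(X * eigen_mat n lam) $$ (i, j) = (\<Sum>l<n. if l = j then X $$ (i, j) * (\<i> * lam j) else 0)"
    unfolding index_mult_mat_sum[OF assms(1) eigen_mat_carrier assms(2,3)] using assms by (intro sum.cong) auto
  moreover have "dim_row X = n" "dim_col X = n" "dim_row (eigen_mat n lam) = n" "dim_col (eigen_mat n lam) = n"
    using assms eigen_mat_carrier by (auto simp del: eigen_mat_carrier)
  ultimately show ?thesis
    using assms by (simp add: ad_def algebra_simps del: index_mult_mat(1))
qed

text \<open>Seen in the frame \<open>g\<close>, the off-diagonal part of X can be divided by the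
  nonzero factors of the commutator and so lies in its image, while the remaining diagonal part
  \<open>W\<close> commutes with the eigenvalue matrix.\<close>

lemma ad_decomposition:
  assumes L: "L \<in> adj_orbit n lam" and X: "X \<in> skew_hermitian n"
    and lam: "\<And>i j. i < n \<Longrightarrow> j < n \<Longrightarrow> i \<noteq> j \<Longrightarrow> lam i \<noteq> lam j"
  obtains A where "A \<in> ad_image n L" "X - A \<in> ad_kernel n L"
proof -
  obtain g where g: "g \<in> unitary_group n" and L_eq: "L = g * eigen_mat n lam * mat_adjoint g"
    using L by (auto simp: adj_orbit_def conj_diag_eq)
  note gc = unitary_group_carrier[OF g]
  note Xc = skew_hermitian_carrier[OF X]
  define Y where "Y = mat_adjoint g * X * g"
  have Yc: "Y \<in> carrier_mat n n"
    using gc Xc by (simp add: Y_def mult_carrier_mat[of _ n n])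
  have X_eq: "X = g * Y * mat_adjoint g"
    unfolding Y_def by (rule unitary_conj_inverse[OF g Xc, symmetric])
  have Y: "Y \<in> skew_hermitian n"
    using skew_hermitian_congruence[OF X, of "mat_adjoint g"] gc by (simp add: Y_def)
  define Z where "Z = mat n n (\<lambda>(i, j). if i = j then 0 else Y $$ (i, j) / (\<i> * (lam i - lam j)))"
  have Zc: "Z \<in> carrier_mat n n"
    by (simp add: Z_def)
  have Z: "Z \<in> skew_hermitian n"
  proof (rule skew_hermitianI[OF Zc])
    fix i j assume ij: "i < n" "j < n"
    then show "Z $$ (j, i) = - cnj (Z $$ (i, j))"
      using lam[OF ij] skew_hermitian_index[OF Y ij] by (auto simp: Z_def field_simps)
  qed
  define A where "A = ad L (g * Z * mat_adjoint g)"
  have A_eq: "A = g * ad (eigen_mat n lam) Z * mat_adjoint g"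
    unfolding A_def L_eq by (rule unitary_conj_ad[OF g eigen_mat_carrier Zc])
  have A: "A \<in> ad_image n L"
    unfolding A_def ad_image_def using skew_hermitian_congruence[OF Z gc] by blast
  have Ask: "A \<in> skew_hermitian n"
    unfolding A_def by (intro skew_hermitian_ad adj_orbit_skew[OF L] skew_hermitian_congruence[OF Z gc])
  define W where "W = Y - ad (eigen_mat n lam) Z"
  have Wc: "W \<in> carrier_mat n n"
    using Yc Zc unfolding W_def by (intro minus_carrier_mat ad_carrier) auto
  have XA: "X - A = g * W * mat_adjoint g"
    unfolding X_eq A_eq W_def using gc Yc Zc by (intro congruence_minus[symmetric]) auto
  have "ad (eigen_mat n lam) W = 0\<^sub>m n n"
  proof (rule eq_matI)
    fix i j assume "i < dim_row (0\<^sub>m n n :: complex mat)" "j < dim_col (0\<^sub>m n n :: complex mat)"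
    then have ij: "i < n" "j < n" by auto
    have "ad (eigen_mat n lam) Z \<in> carrier_mat n n"
      using Zc by simp
    then have "W $$ (i, j) = Y $$ (i, j) - \<i> * (lam i - lam j) * Z $$ (i, j)"
      using ij unfolding W_def by (subst index_minus_mat) (auto simp: ad_eigen_mat_index[OF Zc ij])
    then show "ad (eigen_mat n lam) W $$ (i, j) = 0\<^sub>m n n $$ (i, j)"
      using lam[OF ij] ij by (simp add: ad_eigen_mat_index[OF Wc ij] Z_def)
  qed (simp_all add: ad_def carrier_matD[OF eigen_mat_carrier] carrier_matD[OF Wc])
  then have "ad L (X - A) = g * 0\<^sub>m n n * mat_adjoint g"
    unfolding XA L_eq unitary_conj_ad[OF g eigen_mat_carrier Wc] by simp
  then have "ad L (X - A) = 0\<^sub>m n n"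
    using gc by simp
  then have "X - A \<in> ad_kernel n L"
    using skew_hermitian_minus[OF X Ask] by (simp add: ad_kernel_def)
  with A show thesis by (rule that)
qed

section \<open>The gradient flow of a linear function\<close>

lemma minus_in_ad_kernel:
  assumes L: "L \<in> skew_hermitian n" and X: "X \<in> skew_hermitian n" "Y \<in> skew_hermitian n"
    and eq: "ad L X = ad L Y"
  shows "X - Y \<in> ad_kernel n L"
proof -
  note c = L[THEN skew_hermitian_carrier] X[THEN skew_hermitian_carrier]
  have "ad L (X - Y) = ad L Y - ad L Y"
    using c eq by (simp add: ad_minus)
  also have "\<dots> = 0\<^sub>m n n"
    using ad_carrier[OF c(1,3)] by simp
  finally show ?thesis
    using skew_hermitian_minus[OF X] by (simp add: ad_kernel_def)
qed

text \<open>The factor 1/(2n) cancels the 2n in \<open>kappa\<close>. The argument of the outer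
  commutator already lies in the image of \<open>ad L\<close>, so it is its own image part.\<close>

definition trace_gradient :: "nat \<Rightarrow> complex mat \<Rightarrow> complex mat \<Rightarrow> complex mat" where
  "trace_gradient n N L = ad L (complex_of_real (1 / (2 * real n)) \<cdot>\<^sub>m ad L N)"

text \<open>With Z = [L,N]/(2n) and W = [L,B], where B is in the image, -kappa(Z,B) = -tr([L,N] B) =
  tr(N [L,B]) = tr(W N); the product of traces in \<open>kappa\<close> drops out because commutators
  are traceless.\<close>

lemma normal_metric_trace_gradient:
  assumes n: "n > 0" and L: "L \<in> adj_orbit n lam" and N: "N \<in> skew_hermitian n"
    and W: "W \<in> tangent_space n L"
    and lam: "\<And>i j. i < n \<Longrightarrow> j < n \<Longrightarrow> i \<noteq> j \<Longrightarrow> lam i \<noteq> lam j"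
  shows "normal_metric n L (trace_gradient n N L) W = Re (mat_trace (W * N))"
proof -
  note Ls = adj_orbit_skew[OF L]
  note c = Ls[THEN skew_hermitian_carrier] N[THEN skew_hermitian_carrier]
  define k where "k = complex_of_real (1 / (2 * real n))"
  define Z where "Z = k \<cdot>\<^sub>m ad L N"
  have Zs: "Z \<in> skew_hermitian n"
    unfolding Z_def k_def by (intro skew_hermitian_smult_real skew_hermitian_ad Ls N)
  have "Z = ad L (k \<cdot>\<^sub>m N)"
    unfolding Z_def using ad_smult[OF c] by simp
  then have Z_im: "Z \<in> ad_image n L"
    using skew_hermitian_smult_real[OF N, of "1 / (2 * real n)"] by (auto simp: ad_image_def k_def)
  have V: "trace_gradient n N L = ad L Z"
    by (simp add: trace_gradient_def Z_def k_def)
  \<comment> \<open>Proved for all representatives X and Y of the two tangent vectors, which gives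
    both existence and uniqueness for the description in \<open>normal_metric\<close>.\<close>
  have metric_val: "- Re (kappa n (im_part n L X) (im_part n L Y)) = Re (mat_trace (W * N))"
    if X: "X \<in> skew_hermitian n" "ad L Z = ad L X" and Y: "Y \<in> skew_hermitian n" "W = ad L Y" for X Y
  proof -
    note cY = Y(1)[THEN skew_hermitian_carrier]
    have X': "im_part n L X = Z"
      using minus_in_ad_kernel[OF Ls X(1) Zs X(2)[symmetric]]
      by (intro im_part_eqI Ls Z_im skew_hermitian_carrier[OF X(1)])
    obtain B where B: "B \<in> ad_image n L" "Y - B \<in> ad_kernel n L"
      using ad_decomposition[OF L Y(1) lam] by blast
    then have Y': "im_part n L Y = B"
      by (intro im_part_eqI Ls cY)
    have cB: "B \<in> carrier_mat n n"
      using B(1) c by (auto simp: ad_image_def dest: skew_hermitian_carrier)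
    have diff: "ad L Y - ad L B = 0\<^sub>m n n"
      using B(2) c cY cB by (simp add: ad_kernel_def ad_minus)
    have "ad L B $$ (i, j) = W $$ (i, j)" if "i < n" "j < n" for i j
      using arg_cong[OF diff, of "\<lambda>M. M $$ (i, j)"] that ad_carrier[OF c(1) cB] ad_carrier[OF c(1) cY] Y(2)
      by auto
    then have adB: "ad L B = W"
      using ad_carrier[OF c(1) cB] ad_carrier[OF c(1) cY] Y(2) by (intro eq_matI) auto
    have cN: "ad L N \<in> carrier_mat n n"
      using c by simp
    have "mat_trace (Z * B) = k * mat_trace (ad L N * B)"
      unfolding Z_def mult_smult_assoc_mat[OF cN cB]
      using cN cB by (intro mat_trace_smult) auto
    also have "mat_trace (ad L N * B) = - mat_trace (N * W)"
      unfolding mat_trace_ad_mult[OF c cB] adB ..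
    also have "mat_trace (N * W) = mat_trace (W * N)"
      using c Y ad_carrier[OF c(1) cY] by (intro mat_trace_comm[of _ n n]) auto
    finally have ZB: "mat_trace (Z * B) = - k * mat_trace (W * N)"
      by simp
    have Ztr: "mat_trace Z = 0"
      unfolding Z_def using c by (simp add: mat_trace_smult[OF cN])
    have "kappa n Z B = - mat_trace (W * N)"
      unfolding kappa_def ZB Ztr using n by (simp add: k_def)
    then show ?thesis
      unfolding X' Y' by simp
  qed
  obtain Y where Y: "Y \<in> skew_hermitian n" "W = ad L Y"
    using W by (auto simp: ad_image_def)
  show ?thesis
    unfolding normal_metric_def V
    using metric_val[of Z Y] metric_val Zs Y by (intro the_equality) (force, metis)
qed

lemma mat_trace_mult_has_derivative:
  assumes c: "\<And>s. c s \<in> carrier_mat n n" and N: "N \<in> carrier_mat n n" and "has_mat_derivative n c W t"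
  shows "((\<lambda>s. Re (mat_trace (c s * N))) has_real_derivative Re (mat_trace (W * N))) (at t)"
proof -
  have W: "W \<in> carrier_mat n n"
    using assms(3) by (simp add: has_mat_derivative_def)
  have tr: "mat_trace (A * N) = (\<Sum>i<n. \<Sum>l<n. A $$ (i, l) * N $$ (l, i))" if "A \<in> carrier_mat n n" for A
    using that by (simp add: mat_trace_def index_mult_mat_sum[OF that N] del: index_mult_mat(1))
  have "((\<lambda>s. mat_trace (c s * N)) has_vector_derivative mat_trace (W * N)) (at t)"
    unfolding tr[OF c] tr[OF W]
    using has_mat_derivative_index[OF assms(3)]
    by (intro has_vector_derivative_sum has_vector_derivative_mult_left) auto
  then show ?thesis
    unfolding has_real_derivative_iff_has_vector_derivative
    by (rule bounded_linear.has_vector_derivative[OF bounded_linear_Re])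
qed

lemma is_gradient_trace_gradient:
  assumes n: "n > 0" and L: "L \<in> adj_orbit n lam" and N: "N \<in> skew_hermitian n"
    and lam: "\<And>i j. i < n \<Longrightarrow> j < n \<Longrightarrow> i \<noteq> j \<Longrightarrow> lam i \<noteq> lam j"
  shows "is_gradient n lam (\<lambda>L. Re (mat_trace (L * N))) L (trace_gradient n N L)"
  unfolding is_gradient_def
proof (intro conjI ballI allI impI)
  show "trace_gradient n N L \<in> tangent_space n L"
    unfolding trace_gradient_def ad_image_def
    by (intro imageI skew_hermitian_smult_real skew_hermitian_ad adj_orbit_skew[OF L] N)
  fix W c assume W: "W \<in> tangent_space n L"
    and c: "(\<forall>s. c s \<in> adj_orbit n lam) \<and> c 0 = L \<and> has_mat_derivative n c W 0"
  have "c s \<in> carrier_mat n n" for s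
    using c adj_orbit_skew skew_hermitian_carrier by blast
  then have "((\<lambda>s. Re (mat_trace (c s * N))) has_real_derivative Re (mat_trace (W * N))) (at 0)"
    using c by (intro mat_trace_mult_has_derivative[of _ n] skew_hermitian_carrier[OF N]) auto
  moreover have "normal_metric n L (trace_gradient n N L) W = Re (mat_trace (W * N))"
    by (rule normal_metric_trace_gradient[OF n L N W lam])
  ultimately show "((\<lambda>s. Re (mat_trace (c s * N))) has_real_derivative
      normal_metric n L (trace_gradient n N L) W) (at 0)"
    by simp
qed

text \<open>
  The gradient flow lifts along g \<open>\<mapsto>\<close> conj_diag n lam g to the flow g' = g K(g) on the unitary group.
\<close>

definition frame_velocity :: "nat \<Rightarrow> (nat \<Rightarrow> real) \<Rightarrow> complex mat \<Rightarrow> complex mat \<Rightarrow> complex mat" where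
  "frame_velocity n lam N y =
    complex_of_real (- 1 / (2 * real n)) \<cdot>\<^sub>m ad (eigen_mat n lam) (mat_adjoint y * N * y)"

text \<open>Congruence by any matrix preserves skew-Hermitian matrices. The generality in
  \<open>y\<close> matters, since the retracted equation evaluates the field at non-unitary
  matrices.\<close>

lemma frame_velocity_skew:
  assumes "y \<in> carrier_mat n n" "N \<in> skew_hermitian n"
  shows "frame_velocity n lam N y \<in> skew_hermitian n"
  using skew_hermitian_congruence[OF assms(2), of "mat_adjoint y"] assms
  unfolding frame_velocity_def
  by (intro skew_hermitian_smult_real skew_hermitian_ad eigen_mat_skew) simp

lemma frame_velocity_bdd_lipschitz:
  assumes "mat_bdd_lipschitz n f" "N \<in> carrier_mat n n"
  shows "mat_bdd_lipschitz n (\<lambda>x. frame_velocity n lam N (f x))"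
  unfolding frame_velocity_def ad_def
  by (intro mat_bdd_lipschitz_smult mat_bdd_lipschitz_diff mat_bdd_lipschitz_mult
      mat_bdd_lipschitz_adjoint mat_bdd_lipschitz_const assms eigen_mat_carrier)

text \<open>Here the eigenvalue gaps become weights of entries. In column 0 they are the positive
  numbers (lam 0 - lam i)/(2n) of the first-order inequalities.\<close>

lemma frame_velocity_index:
  assumes "y \<in> carrier_mat n n" "N \<in> carrier_mat n n" "i < n" "j < n"
  shows "frame_velocity n lam N y $$ (i, j)
    = \<i> * (lam j - lam i) / (2 * real n) * (mat_adjoint y * N * y) $$ (i, j)"
proof -
  have c: "mat_adjoint y * N * y \<in> carrier_mat n n"
    using assms by (intro mult_carrier_mat[of _ n n]) auto
  have "ad (eigen_mat n lam) (mat_adjoint y * N * y) \<in> carrier_mat n n"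
    using c by simp
  then have "frame_velocity n lam N y $$ (i, j) = complex_of_real (- 1 / (2 * real n)) *
      (\<i> * (lam i - lam j) * (mat_adjoint y * N * y) $$ (i, j))"
    using assms(3,4) by (simp add: frame_velocity_def ad_eigen_mat_index[OF c assms(3,4)])
  also have "\<dots> = \<i> * (lam j - lam i) / (2 * real n) * (mat_adjoint y * N * y) $$ (i, j)"
    by (cases "n = 0") (simp_all add: field_simps)
  finally show ?thesis .
qed

text \<open>As the velocity k is skew-Hermitian, the derivative of g D g* is g [k,D] g* . Inserting
  k = -[D,M]/(2n), where M is N seen in the moving frame, and using that conjugation commutes with
  commutators gives [L,[L,N]]/(2n).\<close>

lemma conj_diag_has_derivative:
  assumes g: "\<And>s. g s \<in> unitary_group n" and N: "N \<in> skew_hermitian n"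
    and g': "has_mat_derivative n g (g t * frame_velocity n lam N (g t)) t"
  shows "has_mat_derivative n (\<lambda>s. conj_diag n lam (g s)) (trace_gradient n N (conj_diag n lam (g t))) t"
proof -
  define k D where "k = frame_velocity n lam N (g t)" and "D = eigen_mat n lam"
  note gc = unitary_group_carrier[OF g]
  note Nc = skew_hermitian_carrier[OF N]
  have ks: "k \<in> skew_hermitian n"
    unfolding k_def by (rule frame_velocity_skew[OF gc N])
  then have k: "k \<in> carrier_mat n n" "mat_adjoint k = - k"
    by (simp_all add: skew_hermitian_def)
  have D: "D \<in> carrier_mat n n"
    by (simp add: D_def)
  define G H where "G = g t" and "H = mat_adjoint (g t)"
  have GH: "G \<in> carrier_mat n n" "H \<in> carrier_mat n n"
    using gc by (simp_all add: G_def H_def)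
  have "has_mat_derivative n (\<lambda>s. g s * D) (G * 0\<^sub>m n n + G * k * D) t"
    using has_mat_derivative_mult[OF g' has_mat_derivative_const[OF D]] gc D by (simp add: G_def k_def)
  moreover have "G * 0\<^sub>m n n + G * k * D = G * k * D"
    using GH k D by simp
  ultimately have gD: "has_mat_derivative n (\<lambda>s. g s * D) (G * k * D) t"
    by simp
  have "mat_adjoint (G * k) = - k * H"
    using GH k by (subst mat_adjoint_mult[of _ n n _ n]) (auto simp: G_def H_def)
  with has_mat_derivative_adjoint[OF g' gc] have gH: "has_mat_derivative n (\<lambda>s. mat_adjoint (g s)) (- k * H) t"
    by (simp add: G_def k_def)
  have gDc: "g s * D \<in> carrier_mat n n" for s
    using gc D by (intro mult_carrier_mat[of _ n n])
  have "has_mat_derivative n (\<lambda>s. conj_diag n lam (g s)) (G * D * (- k * H) + G * k * D * H) t"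
    using has_mat_derivative_mult[OF gD gH gDc] gc
    by (simp add: conj_diag_eq D_def G_def H_def)
  moreover have "G * D * (- k * H) + G * k * D * H = trace_gradient n N (conj_diag n lam (g t))"
  proof -
    define M where "M = H * N * G"
    have M: "M \<in> carrier_mat n n"
      unfolding M_def using GH Nc by (intro mult_carrier_mat[of _ n n])
    have N_eq: "N = G * M * H"
      unfolding M_def G_def H_def by (rule unitary_conj_inverse[OF g Nc, symmetric])
    define r where "r = complex_of_real (1 / (2 * real n))"
    have k_eq: "k = (- r) \<cdot>\<^sub>m ad D M"
      by (simp add: k_def frame_velocity_def r_def M_def D_def G_def H_def)
    have adM: "ad D M \<in> carrier_mat n n"
      using D M by simp
    have L: "conj_diag n lam (g t) = G * D * H"
      by (simp add: conj_diag_eq D_def G_def H_def)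
    have conj_ad: "ad (G * D * H) (G * A * H) = G * ad D A * H" if "A \<in> carrier_mat n n" for A
      unfolding G_def H_def by (rule unitary_conj_ad[OF g D that])
    have smult: "c \<cdot>\<^sub>m (G * A * H) = G * (c \<cdot>\<^sub>m A) * H" if "A \<in> carrier_mat n n" for c A
      using that GH by (simp add: mult_smult_distrib[of _ n n _ n] mult_smult_assoc_mat[of _ n n _ n] mult_carrier_mat[of _ n n])
    have "ad (G * D * H) N = G * ad D M * H"
      by (subst N_eq) (rule conj_ad[OF M])
    then have "trace_gradient n N (conj_diag n lam (g t)) = ad (G * D * H) (r \<cdot>\<^sub>m (G * ad D M * H))"
      by (simp only: trace_gradient_def L r_def)
    also have "\<dots> = G * ad D (r \<cdot>\<^sub>m ad D M) * H"
      unfolding smult[OF adM] using adM by (intro conj_ad) simp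
    also have "r \<cdot>\<^sub>m ad D M = - k"
      unfolding k_eq by (intro eq_matI) auto
    also have "ad D (- k) = D * (- k) + k * D"
    proof -
      have c: "D * - k \<in> carrier_mat n n" "k * D \<in> carrier_mat n n"
        using D k by (auto intro!: mult_carrier_mat[of _ n n])
      have "- k * D = - (k * D)"
        using D k by (intro uminus_mult_left_mat) simp
      then show ?thesis
        unfolding ad_def by (intro eq_matI)
          (simp_all add: carrier_matD[OF c(1)] carrier_matD[OF c(2)] del: index_mult_mat uminus_mult_right_mat)
    qed
    also have "G * (D * (- k) + k * D) * H = G * D * (- k * H) + G * k * D * H"
    proof -
      have c: "- k \<in> carrier_mat n n" "D * (- k) \<in> carrier_mat n n" "k * D \<in> carrier_mat n n"
        using D k by (auto intro!: mult_carrier_mat[of _ n n])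
      have "G * (D * (- k) + k * D) * H = G * (D * (- k)) * H + G * (k * D) * H"
        unfolding mult_add_distrib_mat[OF GH(1) c(2,3)]
        using c GH by (intro add_mult_distrib_mat[of _ n n]) auto
      also have "G * (D * (- k)) * H = G * D * (- k * H)"
        using c(1) GH D
        by (simp add: assoc_mult_mat[of _ n n _ n _ n] mult_carrier_mat[of _ n n] del: uminus_mult_left_mat uminus_mult_right_mat)
      also have "G * (k * D) * H = G * k * D * H"
        using k GH D by (simp add: assoc_mult_mat[of _ n n _ n _ n] mult_carrier_mat[of _ n n])
      finally show ?thesis .
    qed
    finally show ?thesis ..
  qed
  ultimately show ?thesis by simp
qed

text \<open>Supplies the trajectories to which strict preservation is applied: with
  \<open>S = UNIV\<close> for the first-order conditions, and with a block pattern for the invariant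
  set of the final contradiction.\<close>

theorem gradient_flow_trajectory:
  assumes n: "n > 0" and N: "N \<in> skew_hermitian n" and g0: "g0 \<in> unitary_group n"
    and lam: "\<And>i j. i < n \<Longrightarrow> j < n \<Longrightarrow> i \<noteq> j \<Longrightarrow> lam i \<noteq> lam j"
    and supp0: "\<And>i j. i < n \<Longrightarrow> j < n \<Longrightarrow> (i, j) \<notin> S \<Longrightarrow> g0 $$ (i, j) = 0"
    and supp: "\<And>y i j. y \<in> carrier_mat n n \<Longrightarrow>
      (\<And>i j. i < n \<Longrightarrow> j < n \<Longrightarrow> (i, j) \<notin> S \<Longrightarrow> y $$ (i, j) = 0) \<Longrightarrow>
      i < n \<Longrightarrow> j < n \<Longrightarrow> (i, j) \<notin> S \<Longrightarrow> (y * frame_velocity n lam N y) $$ (i, j) = 0"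
  obtains g where "g 0 = g0" "\<And>t. g t \<in> unitary_group n"
    "\<And>t. has_mat_derivative n g (g t * frame_velocity n lam N (g t)) t"
    "\<And>t i j. i < n \<Longrightarrow> j < n \<Longrightarrow> (i, j) \<notin> S \<Longrightarrow> g t $$ (i, j) = 0"
    "(\<lambda>t. conj_diag n lam (g t)) \<in> gradient_flow n lam (\<lambda>L. Re (mat_trace (L * N)))"
proof -
  obtain g where g: "g 0 = g0" "\<And>t. g t \<in> unitary_group n"
    "\<And>t. has_mat_derivative n g (g t * frame_velocity n lam N (g t)) t"
    "\<And>t i j. i < n \<Longrightarrow> j < n \<Longrightarrow> (i, j) \<notin> S \<Longrightarrow> g t $$ (i, j) = 0"
    using unitary_ode_solution[OF g0 frame_velocity_skew[OF _ N]
        frame_velocity_bdd_lipschitz[OF _ skew_hermitian_carrier[OF N]] supp0 supp] by blast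
  have orbit: "conj_diag n lam (g t) \<in> adj_orbit n lam" for t
    using g(2) by (auto simp: adj_orbit_def)
  have "(\<lambda>t. conj_diag n lam (g t)) \<in> gradient_flow n lam (\<lambda>L. Re (mat_trace (L * N)))"
    unfolding gradient_flow_def
    using orbit is_gradient_trace_gradient[OF n orbit N lam] conj_diag_has_derivative[OF g(2) N g(3)]
    by blast
  with g show thesis by (rule that)
qed

section \<open>Left-justified minors of Vandermonde matrices\<close>

text \<open>Replace the last node by a variable z. The determinant becomes a polynomial of degree at
  most k in z that vanishes at the earlier nodes and whose coefficient at z^k is the smaller
  Vandermonde determinant, so it is that coefficient times the product of the z - y_i.\<close>

lemma vandermonde_det_pos:
  fixes y :: "nat \<Rightarrow> real"
  assumes "\<And>i j. i < j \<Longrightarrow> j < k \<Longrightarrow> y i < y j"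
  shows "0 < det (mat k k (\<lambda>(i, j). y i ^ j))"
  using assms
proof (induction k)
  case 0
  then show ?case by (simp add: det_dim_zero)
next
  case (Suc k)
  define V where "V z = mat (Suc k) (Suc k) (\<lambda>(i, j). (if i = k then z else y i) ^ j)" for z
  have V: "V z \<in> carrier_mat (Suc k) (Suc k)" for z
    by (simp add: V_def)
  define c where "c j = cofactor (V 0) k j" for j
  have del: "mat_delete (V z) k j = mat_delete (V 0) k j" for z j
    by (rule eq_matI) (auto simp: mat_delete_def V_def)
  have det_V: "det (V z) = (\<Sum>j<Suc k. c j * z ^ j)" for z
  proof -
    have "det (V z) = (\<Sum>j<Suc k. V z $$ (k, j) * cofactor (V z) k j)"
      by (rule laplace_expansion_row[OF V]) simp
    also have "\<dots> = (\<Sum>j<Suc k. c j * z ^ j)"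
    proof (rule sum.cong)
      fix j assume "j \<in> {..<Suc k}"
      then have "V z $$ (k, j) = z ^ j"
        by (simp add: V_def)
      then show "V z $$ (k, j) * cofactor (V z) k j = c j * z ^ j"
        by (simp add: c_def cofactor_def del[of z])
    qed simp
    finally show ?thesis .
  qed
  have "mat_delete (V 0) k k = mat k k (\<lambda>(i, j). y i ^ j)"
    by (rule eq_matI) (auto simp: mat_delete_def V_def)
  moreover have "0 < det (mat k k (\<lambda>(i, j). y i ^ j))"
    using Suc.prems less_SucI by (intro Suc.IH) blast
  ultimately have c_pos: "c k > 0"
    by (simp add: c_def cofactor_def)
  define p where "p = (\<Sum>j<Suc k. monom (c j) j)"
  define r where "r = smult (c k) (\<Prod>i<k. [:- y i, 1:])"
  have "p = r"
  proof (rule poly_eqI_degree_lead_coeff[where n = k and A = "y ` {..<k}"])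
    have deg: "degree (\<Prod>i<k. [:- y i, 1:]) = k"
      by (subst degree_prod_eq_sum_degree) auto
    have "coeff (\<Prod>i<k. [:- y i, 1:]) k = 1"
      using lead_coeff_prod[of "\<lambda>i. [:- y i, 1:]" "{..<k}"] by (simp add: deg)
    then show "poly.coeff p k = poly.coeff r k"
      by (simp add: p_def r_def coeff_sum)
    have "inj_on y {..<k}"
    proof (rule inj_onI)
      fix i j assume "i \<in> {..<k}" "j \<in> {..<k}" "y i = y j"
      then show "i = j"
        using Suc.prems[of i j] Suc.prems[of j i] by (cases i j rule: linorder_cases) auto
    qed
    then show "k \<le> card (y ` {..<k})"
      by (simp add: card_image)
    show "degree p \<le> k"
      unfolding p_def by (intro degree_sum_le) (auto intro: order_trans[OF degree_monom_le])
    show "degree r \<le> k"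
      using deg by (simp add: r_def)
    fix z assume "z \<in> y ` {..<k}"
    then obtain i where i: "i < k" "z = y i" by auto
    have "det (V z) = 0"
      using i by (intro Determinant.det_identical_rows[OF V, of i k]) (auto simp: V_def)
    then have "poly p z = 0"
      by (simp add: p_def det_V poly_sum poly_monom)
    moreover have "poly r z = 0"
      using i by (auto simp: r_def poly_prod)
    ultimately show "poly p z = poly r z" by simp
  qed
  then have "poly p (y k) = poly r (y k)"
    by simp
  then have "det (V (y k)) = c k * (\<Prod>i<k. y k - y i)"
    unfolding det_V by (simp add: p_def r_def poly_sum poly_monom poly_prod)
  moreover have "0 < (\<Prod>i<k. y k - y i)"
    using Suc.prems by (intro prod_pos) auto
  moreover have "V (y k) = mat (Suc k) (Suc k) (\<lambda>(i, j). y i ^ j)"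
    by (rule eq_matI) (auto simp: V_def)
  ultimately show ?case
    using c_pos by simp
qed

section \<open>Left-justified minors of real matrices given by their entries\<close>

definition real_minor :: "(nat \<Rightarrow> nat \<Rightarrow> real) \<Rightarrow> nat set \<Rightarrow> real" where
  "real_minor A I = det (mat (card I) (card I) (\<lambda>(i, j). A (pick I i) j))"

lemma pick_less:
  assumes "I \<subseteq> {..<n}" "i < card I"
  shows "pick I i < n"
  using pick_in_set_le[OF assms(2)] assms(1) by auto

lemma pick_lessThan:
  assumes "j < k"
  shows "pick {..<k} j = j"
proof -
  have "{a \<in> {..<k}. a < j} = {..<j}"
    using assms by auto
  then show ?thesis
    using pick_card_in_set[of j "{..<k}"] assms by simp
qed

lemma left_justified_minor_eq_det:
  assumes g: "g \<in> carrier_mat n n" and I: "I \<subseteq> {..<n}"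
  shows "left_justified_minor g I
    = det (mat (card I) (card I) (\<lambda>(i, j). g $$ (pick I i, j)))"
proof -
  have k: "card I \<le> n"
    using card_mono[OF _ I] by simp
  have rows: "{i. i < n \<and> i \<in> I} = I"
    using I by auto
  have cols: "{j. j < n \<and> j < card I} = {..<card I}"
    using k by auto
  have "submatrix g I {..<card I} = mat (card I) (card I) (\<lambda>(i, j). g $$ (pick I i, j))"
    using g k by (intro eq_matI) (auto simp: submatrix_def rows cols pick_lessThan)
  then show ?thesis
    by (simp add: left_justified_minor_def)
qed

definition cmat :: "nat \<Rightarrow> (nat \<Rightarrow> nat \<Rightarrow> real) \<Rightarrow> complex mat" where
  "cmat n A = mat n n (\<lambda>(i, j). complex_of_real (A i j))"

lemma left_justified_minor_cmat:
  assumes I: "I \<subseteq> {..<n}"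
  shows "left_justified_minor (cmat n A) I = complex_of_real (real_minor A I)"
proof -
  have k: "card I \<le> n"
    using card_mono[OF _ I] by simp
  have "mat (card I) (card I) (\<lambda>(i, j). cmat n A $$ (pick I i, j))
      = map_mat complex_of_real (mat (card I) (card I) (\<lambda>(i, j). A (pick I i) j))"
    using k pick_less[OF I] by (intro eq_matI) (auto simp: cmat_def)
  moreover have "cmat n A \<in> carrier_mat n n"
    by (simp add: cmat_def)
  ultimately show ?thesis
    by (simp add: left_justified_minor_eq_det[OF _ I] real_minor_def of_real_hom.hom_det)
qed

text \<open>Row and column scalings by positive numbers multiply a minor by a positive factor, and
  selecting rows of a Vandermonde matrix selects an increasing subset of its nodes.\<close>

lemma real_minor_scaled_vandermonde_pos:
  assumes I: "I \<subseteq> {..<n}" and A: "\<And>i j. A i j = a i * b j * x i ^ j"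
    and pos: "\<And>i. a i > 0" "\<And>j. b j > (0::real)" and x: "\<And>i j. i < j \<Longrightarrow> j < n \<Longrightarrow> x i < x j"
  shows "real_minor A I > 0"
proof -
  define k where "k = card I"
  define V where "V = mat k k (\<lambda>(i, j). x (pick I i) ^ j)"
  have V: "V \<in> carrier_mat k k" by (simp add: V_def)
  have "mat k k (\<lambda>(i, j). A (pick I i) j) = mat_diag k (\<lambda>i. a (pick I i)) * V * mat_diag k b"
    unfolding mat_diag_mult_left[OF V]
    by (subst mat_diag_mult_right[of _ k k]) (auto intro!: eq_matI simp: V_def A)
  then have "real_minor A I = det (mat_diag k (\<lambda>i. a (pick I i))) * det V * det (mat_diag k b)"
    unfolding real_minor_def k_def[symmetric] by (simp add: Determinant.det_mult[of _ k] V mult_carrier_mat[of _ k k])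
  moreover have det_diag: "det (mat_diag k f) > 0" if "\<And>i. f i > (0::real)" for f
  proof -
    have "upper_triangular (mat_diag k f)" by (auto simp: mat_diag_def)
    then show ?thesis
      using that by (subst det_upper_triangular[of _ k])
        (auto simp: mat_diag_def prod_list_diag_prod intro!: prod_pos)
  qed
  moreover have "det V > 0"
    unfolding V_def
  proof (rule vandermonde_det_pos)
    fix i j assume "i < j" "j < k"
    then show "x (pick I i) < x (pick I j)"
      using pick_mono_le[of j I i] pick_less[OF I] by (intro x) (auto simp: k_def)
  qed
  ultimately show ?thesis
    using pos by simp
qed

text \<open>An upper triangular factor on the right mixes the first \<open>card I\<close> columns
  only among themselves, so the submatrix factors through the leading block of R. This is why
  Gram-Schmidt respects the signs of left-justified minors.\<close>

lemma real_minor_upper_triangular_mult: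
  assumes I: "I \<subseteq> {..<n}" and A: "\<And>i j. i < n \<Longrightarrow> j < n \<Longrightarrow> A i j = (\<Sum>k\<le>j. Q i k * R k j)"
  shows "real_minor A I = real_minor Q I * (\<Prod>j<card I. R j j)"
proof -
  define k where "k = card I"
  have kn: "k \<le> n"
    unfolding k_def using card_mono[OF _ I] by simp
  define M U where "M = mat k k (\<lambda>(i, j). Q (pick I i) j)"
    and "U = mat k k (\<lambda>(i, j). if i \<le> j then R i j else 0)"
  have MU: "M \<in> carrier_mat k k" "U \<in> carrier_mat k k"
    by (simp_all add: M_def U_def)
  have "mat k k (\<lambda>(i, j). A (pick I i) j) = M * U"
  proof (rule eq_matI)
    fix i j assume "i < dim_row (M * U)" "j < dim_col (M * U)"
    then have ij: "i < k" "j < k" by (auto simp: M_def U_def)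
    have "(M * U) $$ (i, j) = (\<Sum>l<k. Q (pick I i) l * (if l \<le> j then R l j else 0))"
      using ij by (simp add: M_def U_def scalar_prod_def lessThan_atLeast0)
    also have "\<dots> = (\<Sum>l\<le>j. Q (pick I i) l * R l j)"
      using ij by (intro sum.mono_neutral_cong_right) auto
    also have "\<dots> = A (pick I i) j"
      using ij kn pick_less[OF I] by (subst A) (auto simp: k_def)
    finally show "mat k k (\<lambda>(i, j). A (pick I i) j) $$ (i, j) = (M * U) $$ (i, j)"
      using ij by simp
  qed (auto simp: M_def U_def)
  moreover have "det U = (\<Prod>j<k. R j j)"
    using MU by (subst det_upper_triangular[of _ k])
      (auto simp: U_def prod_list_diag_prod atLeast0LessThan intro!: prod.cong)
  ultimately show ?thesis
    unfolding real_minor_def k_def[symmetric] using Determinant.det_mult[OF MU] by (simp add: M_def k_def)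
qed

section \<open>Gram-Schmidt limits of positive matrices\<close>

definition col_inner :: "nat \<Rightarrow> (nat \<Rightarrow> nat \<Rightarrow> real) \<Rightarrow> (nat \<Rightarrow> nat \<Rightarrow> real) \<Rightarrow> nat \<Rightarrow> nat \<Rightarrow> real" where
  "col_inner n A B j k = (\<Sum>i<n. A i j * B i k)"

text \<open>The recursion is on the column index, with a whole column as its value. For a zero
  residual the division yields the zero column.\<close>

fun gram_schmidt_col :: "nat \<Rightarrow> (nat \<Rightarrow> nat \<Rightarrow> real) \<Rightarrow> nat \<Rightarrow> nat \<Rightarrow> real" where
  "gram_schmidt_col n A j =
    (let u = (\<lambda>i. A i j - (\<Sum>k<j. (\<Sum>l<n. gram_schmidt_col n A k l * A l j) * gram_schmidt_col n A k i))
     in (\<lambda>i. u i / sqrt (\<Sum>l<n. (u l)\<^sup>2)))"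

declare gram_schmidt_col.simps [simp del]

definition gram_schmidt_mat :: "nat \<Rightarrow> (nat \<Rightarrow> nat \<Rightarrow> real) \<Rightarrow> nat \<Rightarrow> nat \<Rightarrow> real" where
  "gram_schmidt_mat n A i j = gram_schmidt_col n A j i"

definition gram_schmidt_residual :: "nat \<Rightarrow> (nat \<Rightarrow> nat \<Rightarrow> real) \<Rightarrow> nat \<Rightarrow> nat \<Rightarrow> real" where
  "gram_schmidt_residual n A i j =
    A i j - (\<Sum>k<j. col_inner n (gram_schmidt_mat n A) A k j * gram_schmidt_mat n A i k)"

definition gram_schmidt_norm :: "nat \<Rightarrow> (nat \<Rightarrow> nat \<Rightarrow> real) \<Rightarrow> nat \<Rightarrow> real" where
  "gram_schmidt_norm n A j = sqrt (\<Sum>l<n. (gram_schmidt_residual n A l j)\<^sup>2)"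

lemma gram_schmidt_mat_eq:
  "gram_schmidt_mat n A i j = gram_schmidt_residual n A i j / gram_schmidt_norm n A j"
  unfolding gram_schmidt_mat_def
  by (subst gram_schmidt_col.simps)
    (simp add: Let_def gram_schmidt_norm_def gram_schmidt_residual_def col_inner_def gram_schmidt_mat_def)

text \<open>The triangular factor R of the QR decomposition.\<close>

definition gram_schmidt_factor :: "nat \<Rightarrow> (nat \<Rightarrow> nat \<Rightarrow> real) \<Rightarrow> nat \<Rightarrow> nat \<Rightarrow> real" where
  "gram_schmidt_factor n A k j =
    (if k < j then col_inner n (gram_schmidt_mat n A) A k j else gram_schmidt_norm n A j)"

text \<open>
  This holds even for linearly dependent columns: there the norm is 0, and so is the residual.
\<close>

lemma gram_schmidt_factorization:
  assumes "i < n"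
  shows "A i j = (\<Sum>k\<le>j. gram_schmidt_mat n A i k * gram_schmidt_factor n A k j)"
proof -
  have "gram_schmidt_residual n A i j = gram_schmidt_mat n A i j * gram_schmidt_norm n A j"
  proof (cases "gram_schmidt_norm n A j = 0")
    case True
    then have "(\<Sum>l<n. (gram_schmidt_residual n A l j)\<^sup>2) = 0"
      by (simp add: gram_schmidt_norm_def)
    then have "gram_schmidt_residual n A i j = 0"
      using assms by (subst (asm) sum_nonneg_eq_0_iff) auto
    with True show ?thesis by simp
  qed (simp add: gram_schmidt_mat_eq)
  then have "A i j = (\<Sum>k<j. gram_schmidt_mat n A i k * col_inner n (gram_schmidt_mat n A) A k j)
      + gram_schmidt_mat n A i j * gram_schmidt_norm n A j"
    by (simp add: gram_schmidt_residual_def mult.commute)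
  then show ?thesis
    by (simp add: gram_schmidt_factor_def flip: lessThan_Suc_atMost)
qed

lemma gram_schmidt_orthonormal:
  assumes norm: "\<And>j. j < n \<Longrightarrow> gram_schmidt_norm n A j \<noteq> 0"
  shows "j < n \<Longrightarrow> k \<le> j \<Longrightarrow>
    col_inner n (gram_schmidt_mat n A) (gram_schmidt_mat n A) k j = (if k = j then 1 else 0)"
proof (induction j arbitrary: k rule: less_induct)
  case (less j)
  let ?Q = "gram_schmidt_mat n A"
  have sym: "col_inner n ?Q ?Q k m = col_inner n ?Q ?Q m k" for k m
    by (simp add: col_inner_def mult.commute)
  have IH: "col_inner n ?Q ?Q k m = (if k = m then 1 else 0)" if "k < j" "m < j" for k m
    using less.IH[of m k] less.IH[of k m] less.prems that sym[of k m] by (cases "k \<le> m") auto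
  show ?case
  proof (cases "k = j")
    case True
    have "col_inner n ?Q ?Q j j = (\<Sum>i<n. (gram_schmidt_residual n A i j)\<^sup>2) / (gram_schmidt_norm n A j)\<^sup>2"
      by (simp add: col_inner_def gram_schmidt_mat_eq[of n A _ j] sum_divide_distrib power2_eq_square)
    moreover have "(gram_schmidt_norm n A j)\<^sup>2 = (\<Sum>i<n. (gram_schmidt_residual n A i j)\<^sup>2)"
      by (simp add: gram_schmidt_norm_def sum_nonneg)
    ultimately have "col_inner n ?Q ?Q j j = (gram_schmidt_norm n A j)\<^sup>2 / (gram_schmidt_norm n A j)\<^sup>2"
      by (simp only:)
    then show ?thesis
      using norm[OF less.prems(1)] True by simp
  next
    case False
    then have k: "k < j" using less.prems by simp
    have "(\<Sum>i<n. ?Q i k * gram_schmidt_residual n A i j)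
        = col_inner n ?Q A k j - (\<Sum>m<j. col_inner n ?Q A m j * col_inner n ?Q ?Q k m)"
      unfolding gram_schmidt_residual_def col_inner_def[of n ?Q A k j] col_inner_def[of n ?Q ?Q k]
      by (simp add: right_diff_distrib sum_subtractf sum_distrib_left mult.left_commute sum.swap[of _ "{..<n}"])
    also have "(\<Sum>m<j. col_inner n ?Q A m j * col_inner n ?Q ?Q k m) = (\<Sum>m<j. if m = k then col_inner n ?Q A k j else 0)"
      using IH[OF k] by (intro sum.cong) auto
    also have "\<dots> = col_inner n ?Q A k j"
      using k by simp
    finally have "(\<Sum>i<n. ?Q i k * gram_schmidt_residual n A i j) = 0" by simp
    then have "col_inner n ?Q ?Q k j = 0"
      by (simp add: col_inner_def gram_schmidt_mat_eq[of n A _ j] flip: sum_divide_distrib)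
    with False show ?thesis by simp
  qed
qed

text \<open>Uniqueness of the QR decomposition with positive diagonal: once the earlier columns
  agree with Q, the inner products read off column j of R and leave the residual R j j times column
  j of Q. It evaluates Gram-Schmidt from a guessed factorization.\<close>

lemma gram_schmidt_unique:
  assumes Q: "\<And>j k. j < n \<Longrightarrow> k < n \<Longrightarrow> col_inner n Q Q j k = (if j = k then 1 else 0)"
    and A: "\<And>i j. i < n \<Longrightarrow> j < n \<Longrightarrow> A i j = (\<Sum>k\<le>j. Q i k * R k j)"
    and R: "\<And>j. j < n \<Longrightarrow> R j j > 0"
  shows "j < n \<Longrightarrow> gram_schmidt_norm n A j = R j j \<and> (\<forall>i<n. gram_schmidt_mat n A i j = Q i j)"
proof (induction j rule: less_induct)
  case (less j)
  have inner: "col_inner n (gram_schmidt_mat n A) A k j = R k j" if k: "k < j" for k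
  proof -
    have "col_inner n (gram_schmidt_mat n A) A k j = (\<Sum>i<n. Q i k * (\<Sum>m\<le>j. Q i m * R m j))"
      unfolding col_inner_def using less k A by (intro sum.cong) auto
    also have "\<dots> = (\<Sum>m\<le>j. R m j * col_inner n Q Q k m)"
      unfolding col_inner_def
      by (simp add: sum_distrib_left sum_distrib_right mult_ac sum.swap[of _ "{..<n}"])
    also have "\<dots> = (\<Sum>m\<le>j. if m = k then R k j else 0)"
      using less.prems k Q by (intro sum.cong) auto
    also have "\<dots> = R k j"
      using k by simp
    finally show ?thesis .
  qed
  have res: "gram_schmidt_residual n A i j = Q i j * R j j" if i: "i < n" for i
  proof -
    have "gram_schmidt_residual n A i j = (\<Sum>k\<le>j. Q i k * R k j) - (\<Sum>k<j. R k j * Q i k)"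
      unfolding gram_schmidt_residual_def A[OF i less.prems] using less i inner
      by (intro arg_cong2[where f = minus] sum.cong refl) auto
    then show ?thesis
      by (simp add: mult.commute flip: lessThan_Suc_atMost)
  qed
  have "(\<Sum>l<n. (gram_schmidt_residual n A l j)\<^sup>2) = (R j j)\<^sup>2 * col_inner n Q Q j j"
    by (simp add: res col_inner_def sum_distrib_left power2_eq_square mult_ac)
  then have norm: "gram_schmidt_norm n A j = R j j"
    using R Q less.prems by (simp add: gram_schmidt_norm_def less_imp_le)
  with res R[OF less.prems] show ?case
    by (simp add: gram_schmidt_mat_eq)
qed

text \<open>Each column arises from the earlier ones by continuous operations and one division,
  whose denominator has a nonzero limit.\<close>

lemma gram_schmidt_tendsto:
  assumes A: "\<And>i j. i < n \<Longrightarrow> j < n \<Longrightarrow> ((\<lambda>m. A m i j) \<longlongrightarrow> B i j) F"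
    and norm: "\<And>j. j < n \<Longrightarrow> gram_schmidt_norm n B j \<noteq> 0"
  shows "j < n \<Longrightarrow> i < n \<Longrightarrow> ((\<lambda>m. gram_schmidt_mat n (A m) i j) \<longlongrightarrow> gram_schmidt_mat n B i j) F"
proof (induction j arbitrary: i rule: less_induct)
  case (less j)
  have res: "((\<lambda>m. gram_schmidt_residual n (A m) l j) \<longlongrightarrow> gram_schmidt_residual n B l j) F" if "l < n" for l
    unfolding gram_schmidt_residual_def col_inner_def
    using less that by (intro tendsto_intros A less.IH) auto
  have "((\<lambda>m. gram_schmidt_norm n (A m) j) \<longlongrightarrow> gram_schmidt_norm n B j) F"
    unfolding gram_schmidt_norm_def by (intro tendsto_intros res) auto
  with res less.prems norm show ?case
    unfolding gram_schmidt_mat_eq by (intro tendsto_divide) auto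
qed

lemma orthonormal_cmat_unitary:
  assumes "\<And>j k. j < n \<Longrightarrow> k < n \<Longrightarrow> col_inner n Q Q j k = (if j = k then 1 else 0)"
  shows "cmat n Q \<in> unitary_group n"
proof -
  have g: "cmat n Q \<in> carrier_mat n n"
    by (simp add: cmat_def)
  have "mat_adjoint (cmat n Q) * cmat n Q = 1\<^sub>m n"
  proof (rule eq_matI)
    fix i j assume "i < dim_row (1\<^sub>m n :: complex mat)" "j < dim_col (1\<^sub>m n :: complex mat)"
    then have ij: "i < n" "j < n" by auto
    have "(mat_adjoint (cmat n Q) * cmat n Q) $$ (i, j)
        = (\<Sum>l<n. mat_adjoint (cmat n Q) $$ (i, l) * cmat n Q $$ (l, j))"
      by (rule index_mult_mat_sum[OF mat_adjoint_carrier[OF g] g ij])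
    also have "\<dots> = complex_of_real (col_inner n Q Q i j)"
      using ij by (auto simp: cmat_def col_inner_def intro!: sum.cong)
    finally show "(mat_adjoint (cmat n Q) * cmat n Q) $$ (i, j) = 1\<^sub>m n $$ (i, j)"
      using ij assms by simp
  qed (auto simp: cmat_def)
  then have "cmat n Q * mat_adjoint (cmat n Q) = 1\<^sub>m n"
    by (rule mat_mult_left_right_inverse[OF mat_adjoint_carrier[OF g] g])
  then show ?thesis
    using g by (simp add: unitary_group_def)
qed

text \<open>The minor on all rows is nonzero, so no norm vanishes; then every minor of the
  orthonormalized matrix is the old one divided by a product of positive norms.\<close>

lemma gram_schmidt_unitary_pos:
  assumes minors: "\<And>I. I \<subseteq> {..<n} \<Longrightarrow> real_minor A I > 0"
  shows "cmat n (gram_schmidt_mat n A) \<in> unitary_pos n"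
proof -
  let ?Q = "gram_schmidt_mat n A" and ?R = "gram_schmidt_factor n A"
  have mult: "real_minor A I = real_minor ?Q I * (\<Prod>j<card I. ?R j j)" if "I \<subseteq> {..<n}" for I
    by (rule real_minor_upper_triangular_mult[OF that gram_schmidt_factorization])
  have "0 < real_minor ?Q {..<n} * (\<Prod>j<n. ?R j j)"
    using minors[of "{..<n}"] mult[of "{..<n}"] by simp
  then have "(\<Prod>j<n. ?R j j) \<noteq> 0"
    by (metis less_irrefl mult_zero_right)
  then have norm: "gram_schmidt_norm n A j \<noteq> 0" if "j < n" for j
    using that by (auto simp: gram_schmidt_factor_def)
  then have norm_pos: "gram_schmidt_norm n A j > 0" if "j < n" for j
    using that by (simp add: gram_schmidt_norm_def sum_nonneg order.strict_iff_order)
  have minor_pos: "real_minor ?Q I > 0" if I: "I \<subseteq> {..<n}" for I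
  proof -
    have "card I \<le> n"
      using card_mono[OF _ I] by simp
    then have "(\<Prod>j<card I. ?R j j) > 0"
      using norm_pos by (intro prod_pos) (auto simp: gram_schmidt_factor_def)
    with minors[OF I] mult[OF I] show ?thesis
      by (simp add: zero_less_mult_iff)
  qed
  have "col_inner n ?Q ?Q i j = (if i = j then 1 else 0)" if "i < n" "j < n" for i j
    using gram_schmidt_orthonormal[OF norm, where j = j and k = i]
      gram_schmidt_orthonormal[OF norm, where j = i and k = j] that
    by (cases "i \<le> j") (auto simp: col_inner_def mult.commute)
  then have "cmat n ?Q \<in> unitary_group n"
    by (rule orthonormal_cmat_unitary)
  then show ?thesis
    using minor_pos left_justified_minor_cmat[of _ n ?Q]
    by (simp add: unitary_pos_def)
qed

text \<open>
  The powers of t with these exponents form a rescaled Vandermonde matrix in the nodes \<open>t ^ (-2 i)\<close>,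
  except that the node of row 2 is moved to \<open>t ^ (-3)\<close>, where the exponent 0 is attained in columns 1
  and 2.
\<close>

definition lacunary_exponent :: "nat \<Rightarrow> nat \<Rightarrow> nat" where
  "lacunary_exponent i j =
    (if i = 2 then nat ((int j - 1) * (int j - 2)) else nat ((int i - int j)\<^sup>2))"

lemma lacunary_exponent_eq_0_iff: "lacunary_exponent i j = 0 \<longleftrightarrow> i = j \<or> i = 2 \<and> j = 1"
proof (cases "i = 2")
  case True
  have "(int j - 1) * (int j - 2) \<le> 0 \<longleftrightarrow> j = 1 \<or> j = 2"
    by (auto simp: mult_le_0_iff)
  with True show ?thesis
    by (auto simp: lacunary_exponent_def)
qed (auto simp: lacunary_exponent_def)

text \<open>Expanding the square, or (j - 1)(j - 2), leaves a row part, a column part and a mixed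
  term linear in j; the mixed term gives the Vandermonde node. It stands on the left to avoid
  subtraction of natural numbers.\<close>

lemma lacunary_exponent_split:
  "lacunary_exponent i j + (if i = 2 then 3 else 2 * i) * j = (if i = 2 then 2 else i\<^sup>2) + j\<^sup>2"
proof -
  \<comment> \<open>A product of two consecutive integers is nonnegative, so \<open>nat\<close>
    loses nothing.\<close>
  have "0 \<le> (int j - 1) * (int j - 2)"
    by (cases "j = 0"; cases "j = 1") (auto intro: mult_nonneg_nonneg)
  then have "int (lacunary_exponent i j)
      = (if i = 2 then (int j - 1) * (int j - 2) else (int i - int j)\<^sup>2)"
    by (simp add: lacunary_exponent_def)
  then have "int (lacunary_exponent i j + (if i = 2 then 3 else 2 * i) * j)
      = int ((if i = 2 then 2 else i\<^sup>2) + j\<^sup>2)"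
    by (simp add: power2_eq_square algebra_simps)
  then show ?thesis
    using of_nat_eq_iff by blast
qed

text \<open>The row weights \<open>w\<close> survive in the limit t -> 0. Chosen as c and s in rows
  1 and 2, they put the direction (c, s) into column 1.\<close>

definition lacunary_mat :: "(nat \<Rightarrow> real) \<Rightarrow> real \<Rightarrow> nat \<Rightarrow> nat \<Rightarrow> real" where
  "lacunary_mat w t i j = w i * t ^ lacunary_exponent i j"

lemma lacunary_mat_minor_pos:
  assumes t: "0 < t" "t < 1" and w: "\<And>i. w i > 0" and I: "I \<subseteq> {..<n}"
  shows "real_minor (lacunary_mat w t) I > 0"
proof (rule real_minor_scaled_vandermonde_pos[OF I, where a = "\<lambda>i. w i * t ^ (if i = 2 then 2 else i\<^sup>2)"
      and b = "\<lambda>j. t ^ j\<^sup>2" and x = "\<lambda>i. inverse t ^ (if i = 2 then 3 else 2 * i)"])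
  fix i j :: nat
  define d where "d = (if i = 2 then 3 else 2 * i)"
  have "t ^ lacunary_exponent i j * t ^ (d * j) = t ^ (if i = 2 then 2 else i\<^sup>2) * t ^ j\<^sup>2"
    using lacunary_exponent_split[of i j] by (simp add: d_def flip: power_add)
  moreover have "(inverse t ^ d) ^ j * t ^ (d * j) = 1"
    using t by (simp add: power_inverse flip: power_mult)
  ultimately show "lacunary_mat w t i j = w i * t ^ (if i = 2 then 2 else i\<^sup>2) * t ^ j\<^sup>2 *
      (inverse t ^ (if i = 2 then 3 else 2 * i)) ^ j"
    unfolding d_def[symmetric] lacunary_mat_def using t by (simp add: field_simps)
next
  fix i j :: nat assume ij: "i < j"
  \<comment> \<open>The displaced exponent 3 still lies strictly between its neighbours 2 and 6, so
    the nodes remain increasing.\<close>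
  have "(if i = 2 then 3 else 2 * i) < (if j = 2 then 3 else 2 * j)"
    using ij by auto
  moreover have "inverse t > 1"
    using t by (simp add: one_less_inverse)
  ultimately show "inverse t ^ (if i = 2 then 3 else 2 * i) < inverse t ^ (if j = 2 then 3 else 2 * j)"
    by (rule power_strict_increasing)
qed (use t w in auto)

lemma lacunary_mat_tendsto:
  "((\<lambda>t. lacunary_mat w t i j) \<longlongrightarrow> (if i = j \<or> i = 2 \<and> j = 1 then w i else 0)) (at_right 0)"
proof (cases "i = j \<or> i = 2 \<and> j = 1")
  case True
  then have "lacunary_exponent i j = 0"
    by (simp only: lacunary_exponent_eq_0_iff)
  then show ?thesis
    unfolding if_P[OF True] by (simp add: lacunary_mat_def)
next
  case False
  then have "lacunary_exponent i j \<noteq> 0"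
    by (simp only: lacunary_exponent_eq_0_iff) simp
  moreover have "((\<lambda>t::real. w i * t ^ lacunary_exponent i j) \<longlongrightarrow> w i * 0 ^ lacunary_exponent i j) (at_right 0)"
    by (intro tendsto_intros)
  ultimately show ?thesis
    unfolding if_not_P[OF False] by (simp add: lacunary_mat_def zero_power)
qed

section \<open>Rotations in the coordinates 1 and 2 as limits of positive frames\<close>

definition rotation12 :: "real \<Rightarrow> real \<Rightarrow> nat \<Rightarrow> nat \<Rightarrow> real" where
  "rotation12 c s i j = (if i = 1 \<and> j = 1 \<or> i = 2 \<and> j = 2 then c else if i = 2 \<and> j = 1 then s
     else if i = 1 \<and> j = 2 then - s else if i = j then 1 else 0)"

lemma sum_rotation12:
  fixes f :: "nat \<Rightarrow> 'a::real_vector"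
  assumes n: "n \<ge> 3" and j: "j < n"
  shows "(\<Sum>i<n. rotation12 c s i j *\<^sub>R f i) =
    (if j = 1 then c *\<^sub>R f 1 + s *\<^sub>R f 2 else if j = 2 then c *\<^sub>R f 2 - s *\<^sub>R f 1 else f j)"
proof -
  have "(\<Sum>i<n. rotation12 c s i j *\<^sub>R f i)
      = (\<Sum>i\<in>(if j = 1 \<or> j = 2 then {1, 2} else {j}). rotation12 c s i j *\<^sub>R f i)"
    using n j by (intro sum.mono_neutral_right) (auto simp: rotation12_def)
  then show ?thesis
    by (auto simp: rotation12_def)
qed

lemma rotation12_orthonormal:
  assumes "n \<ge> 3" "c\<^sup>2 + s\<^sup>2 = 1" "j < n" "k < n"
  shows "col_inner n (rotation12 c s) (rotation12 c s) j k = (if j = k then 1 else 0)"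
proof -
  have inner: "col_inner n (rotation12 c s) (rotation12 c s) j k
      = (\<Sum>i<n. rotation12 c s i j *\<^sub>R rotation12 c s i k)"
    by (simp add: col_inner_def)
  have cs: "c * c + s * s = 1"
    using assms(2) by (simp add: power2_eq_square)
  show ?thesis
    unfolding inner sum_rotation12[OF assms(1,3)] using cs
    by (cases "j = 1"; cases "j = 2"; cases "k = 1"; cases "k = 2") (simp_all add: rotation12_def add.commute)
qed

text \<open>\<open>B\<close> is the limit of the lacunary matrices. Its columns 1 and 2 are (c, s)
  and (0, s) in the coordinates 1 and 2, and orthonormalizing them gives the rotation.\<close>

lemma gram_schmidt_rotation12:
  assumes n: "n \<ge> 3" and cs: "c > 0" "s > 0" "c\<^sup>2 + s\<^sup>2 = 1" and j: "j < n"
  defines "B \<equiv> \<lambda>i j. if i = j \<or> i = 2 \<and> j = 1 then (if i = 1 then c else if i = 2 then s else 1) else 0"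
  shows "gram_schmidt_norm n B j \<noteq> 0" "i < n \<Longrightarrow> gram_schmidt_mat n B i j = rotation12 c s i j"
proof -
  \<comment> \<open>In column 2, the entries are the inner products of (0, s) with (c, s) and (-s,
    c); the second is positive because the angle is acute.\<close>
  define R where "R k j = (if k = 1 \<and> j = 2 then s\<^sup>2 else if k = 2 \<and> j = 2 then s * c
    else if k = j then 1 else 0)" for k j :: nat
  have "B i j = (\<Sum>k\<le>j. rotation12 c s i k * R k j)" for i j
  proof -
    have "(\<Sum>k\<le>j. rotation12 c s i k * R k j)
        = (\<Sum>k\<in>(if j = 2 then {1, 2} else {j}). rotation12 c s i k * R k j)"
      by (intro sum.mono_neutral_right) (auto simp: R_def)
    also have "\<dots> = B i j"
    proof (cases "j = 2 \<and> i = 2")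
      case True
      have "s * s\<^sup>2 + c * (s * c) = s * (c\<^sup>2 + s\<^sup>2)"
        by (simp add: power2_eq_square algebra_simps)
      with True cs show ?thesis
        by (simp add: R_def B_def rotation12_def)
    qed (auto simp: R_def B_def rotation12_def power2_eq_square)
    finally show ?thesis ..
  qed
  moreover have "R j j > 0" for j
    using cs by (simp add: R_def)
  ultimately have "gram_schmidt_norm n B j = R j j \<and> (\<forall>i<n. gram_schmidt_mat n B i j = rotation12 c s i j)"
    using gram_schmidt_unique[OF rotation12_orthonormal[OF n cs(3)] _ _ j, of B R] by blast
  with \<open>R j j > 0\<close> show "gram_schmidt_norm n B j \<noteq> 0"
    "i < n \<Longrightarrow> gram_schmidt_mat n B i j = rotation12 c s i j"
    by auto
qed

section \<open>Positivity of frames\<close>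

lemma conj_diag_index:
  assumes "g \<in> carrier_mat n n" "i < n" "j < n"
  shows "conj_diag n lam g $$ (i, j) = (\<Sum>l<n. g $$ (i, l) * (\<i> * lam l) * cnj (g $$ (j, l)))"
proof -
  have gE: "(g * eigen_mat n lam) $$ (i, l) = g $$ (i, l) * (\<i> * lam l)" if "l < n" for l
  proof -
    have "(g * eigen_mat n lam) $$ (i, l) = (\<Sum>m<n. if m = l then g $$ (i, l) * (\<i> * lam l) else 0)"
      unfolding index_mult_mat_sum[OF assms(1) eigen_mat_carrier assms(2) that]
      using assms that by (intro sum.cong) auto
    then show ?thesis
      using that by simp
  qed
  have "conj_diag n lam g $$ (i, j) = (\<Sum>l<n. (g * eigen_mat n lam) $$ (i, l) * mat_adjoint g $$ (l, j))"
    unfolding conj_diag_eq using assms by (intro index_mult_mat_sum[of _ n n]) (auto intro: mult_carrier_mat)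
  also have "\<dots> = (\<Sum>l<n. g $$ (i, l) * (\<i> * lam l) * cnj (g $$ (j, l)))"
    using assms by (intro sum.cong refl) (auto simp: gE simp del: index_mult_mat(1))
  finally show ?thesis .
qed

lemma conj_diag_carrier: "g \<in> carrier_mat n n \<Longrightarrow> conj_diag n lam g \<in> carrier_mat n n"
  unfolding conj_diag_eq by (intro mult_carrier_mat) auto

text \<open>The closure is taken in the orbit picture, so the convergence of the orthonormalized
  lacunary matrices is carried from frames to orbit points, whose entries are polynomial in those of
  the frame and their conjugates.\<close>

lemma conj_diag_rotation12_nonneg:
  assumes n: "n \<ge> 3" and cs: "c > 0" "s > 0" "c\<^sup>2 + s\<^sup>2 = 1"
  shows "conj_diag n lam (cmat n (rotation12 c s)) \<in> adj_orbit_nonneg n lam"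
  unfolding adj_orbit_nonneg_def mat_closure_def
proof (intro CollectI conjI allI impI)
  show "conj_diag n lam (cmat n (rotation12 c s)) \<in> carrier_mat n n"
    by (intro conj_diag_carrier) (simp add: cmat_def)
  fix e :: real assume e: "e > 0"
  define w where "w i = (if i = 1 then c else if i = 2 then s else 1)" for i :: nat
  define B where "B i j = (if i = j \<or> i = 2 \<and> j = 1 then w i else 0)" for i j
  define g where "g t = cmat n (gram_schmidt_mat n (lacunary_mat w t))" for t
  have Q: "gram_schmidt_norm n B j \<noteq> 0" "i < n \<Longrightarrow> gram_schmidt_mat n B i j = rotation12 c s i j"
    if "j < n" for i j
    using gram_schmidt_rotation12[OF n cs that] unfolding B_def w_def by auto
  have g_lim: "((\<lambda>t. g t $$ (i, j)) \<longlongrightarrow> cmat n (rotation12 c s) $$ (i, j)) (at_right 0)"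
    if ij: "i < n" "j < n" for i j
  proof -
    have "((\<lambda>t. gram_schmidt_mat n (lacunary_mat w t) i j) \<longlongrightarrow> gram_schmidt_mat n B i j) (at_right 0)"
      by (rule gram_schmidt_tendsto[OF _ Q(1) ij(2,1)]) (unfold B_def, rule lacunary_mat_tendsto)
    then show ?thesis
      using ij by (simp add: g_def cmat_def Q(2) tendsto_of_real)
  qed
  have lim: "((\<lambda>t. conj_diag n lam (g t) $$ (i, j)) \<longlongrightarrow> conj_diag n lam (cmat n (rotation12 c s)) $$ (i, j)) (at_right 0)"
    if ij: "i < n" "j < n" for i j
  proof -
    have "g t \<in> carrier_mat n n" "cmat n (rotation12 c s) \<in> carrier_mat n n" for t
      by (simp_all add: g_def cmat_def)
    then show ?thesis
      using ij by (simp add: conj_diag_index) (intro tendsto_intros g_lim; simp)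
  qed
  then have "\<forall>\<^sub>F t in at_right 0.
      cmod (conj_diag n lam (g t) $$ (i, j) - conj_diag n lam (cmat n (rotation12 c s)) $$ (i, j)) < e"
    if "i < n" "j < n" for i j
    using tendstoD[OF lim[OF that] e] by (simp add: dist_norm)
  then have "\<forall>\<^sub>F t in at_right 0. \<forall>i\<in>{..<n}. \<forall>j\<in>{..<n}.
      cmod (conj_diag n lam (g t) $$ (i, j) - conj_diag n lam (cmat n (rotation12 c s)) $$ (i, j)) < e"
    by (intro eventually_ball_finite ballI) auto
  moreover have "\<forall>\<^sub>F t::real in at_right 0. 0 < t \<and> t < 1"
    using eventually_at_right_real[of 0 1] by auto
  ultimately have "\<forall>\<^sub>F t in at_right 0. (0 < t \<and> t < 1) \<and> (\<forall>i\<in>{..<n}. \<forall>j\<in>{..<n}.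
      cmod (conj_diag n lam (g t) $$ (i, j) - conj_diag n lam (cmat n (rotation12 c s)) $$ (i, j)) < e)"
    by eventually_elim simp
  then obtain t where t: "0 < t" "t < 1" and close: "\<And>i j. i < n \<Longrightarrow> j < n \<Longrightarrow>
      cmod (conj_diag n lam (g t) $$ (i, j) - conj_diag n lam (cmat n (rotation12 c s)) $$ (i, j)) < e"
    using eventually_happens'[OF trivial_limit_at_right_real] by (metis (no_types, lifting) lessThan_iff)
  have "g t \<in> unitary_pos n"
    unfolding g_def using t cs by (intro gram_schmidt_unitary_pos lacunary_mat_minor_pos) (auto simp: w_def)
  with close show "\<exists>M\<in>adj_orbit_pos n lam. \<forall>i<n. \<forall>j<n.
      cmod (M $$ (i, j) - conj_diag n lam (cmat n (rotation12 c s)) $$ (i, j)) < e"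
    unfolding adj_orbit_pos_def by blast
qed

text \<open>The matrix \<open>W\<close>, which carries the frame \<open>g\<close> to
  \<open>h\<close>, commutes with a diagonal matrix with distinct entries and is therefore
  diagonal.\<close>

lemma conj_diag_eq_imp_column_scaling:
  assumes g: "g \<in> unitary_group n" and h: "h \<in> unitary_group n"
    and eq: "conj_diag n lam g = conj_diag n lam h"
    and lam: "\<And>i j. i < n \<Longrightarrow> j < n \<Longrightarrow> i \<noteq> j \<Longrightarrow> lam i \<noteq> lam j"
  obtains u where "\<And>i j. i < n \<Longrightarrow> j < n \<Longrightarrow> h $$ (i, j) = g $$ (i, j) * u j"
proof -
  note c = unitary_group_carrier[OF g] unitary_group_carrier[OF h]
  define D where "D = eigen_mat n lam"
  have D: "D \<in> carrier_mat n n" by (simp add: D_def)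
  define W where "W = mat_adjoint g * h"
  have W: "W \<in> carrier_mat n n"
    unfolding W_def using c by (intro mult_carrier_mat[of _ n n]) auto
  have "D * W = mat_adjoint g * g * D * mat_adjoint g * h"
    using c D unfolding unitary_groupD(2)[OF g] W_def
    by (simp add: assoc_mult_mat[of _ n n _ n _ n] mult_carrier_mat[of _ n n] left_mult_one_mat[of _ n n])
  also have "\<dots> = mat_adjoint g * (g * D * mat_adjoint g) * h"
    using c D by (simp add: assoc_mult_mat[of _ n n _ n _ n] mult_carrier_mat[of _ n n])
  also have "g * D * mat_adjoint g = h * D * mat_adjoint h"
    using eq by (simp add: conj_diag_eq D_def)
  also have "mat_adjoint g * (h * D * mat_adjoint h) * h = mat_adjoint g * h * D * (mat_adjoint h * h)"
    using c D by (simp add: assoc_mult_mat[of _ n n _ n _ n] mult_carrier_mat[of _ n n])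
  also have "\<dots> = W * D"
    using c D unfolding unitary_groupD(2)[OF h] W_def
    by (simp add: assoc_mult_mat[of _ n n _ n _ n] mult_carrier_mat[of _ n n] right_mult_one_mat[of _ n n])
  finally have DW: "D * W = W * D" .
  have W_diag: "W $$ (i, j) = 0" if ij: "i < n" "j < n" "i \<noteq> j" for i j
  proof -
    have "ad D W $$ (i, j) = 0"
      using ij D W by (simp add: ad_def DW del: index_mult_mat(1))
    then show ?thesis
      using lam[OF ij] by (simp add: D_def ad_eigen_mat_index[OF W ij(1,2)])
  qed
  have "h = g * mat_adjoint g * h"
    using c by (simp add: unitary_groupD(1)[OF g])
  also have "\<dots> = g * W"
    using c by (simp add: W_def assoc_mult_mat[of _ n n _ n _ n])
  finally have h_eq: "h = g * W" .
  have "h $$ (i, j) = g $$ (i, j) * W $$ (j, j)" if ij: "i < n" "j < n" for i j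
  proof -
    have "h $$ (i, j) = (\<Sum>l<n. if l = j then g $$ (i, j) * W $$ (j, j) else 0)"
      unfolding h_eq index_mult_mat_sum[OF c(1) W ij] using ij W_diag by (intro sum.cong) auto
    then show ?thesis using ij by simp
  qed
  then show thesis by (rule that)
qed

lemma pick_insert2:
  assumes "a < b"
  shows "pick {a, b} 0 = a" "pick {a, b} (Suc 0) = b"
proof -
  have sets: "{x \<in> {a, b}. x < a} = {}" "{x \<in> {a, b}. x < b} = {a}"
    using assms by auto
  have card_single: "card {a} = Suc 0"
    by simp
  show "pick {a, b} 0 = a"
    by (rule pick_card_in_set[of a "{a, b}", unfolded sets card.empty]) simp
  show "pick {a, b} (Suc 0) = b"
    by (rule pick_card_in_set[of b "{a, b}", unfolded sets card_single]) simp
qed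

lemma left_justified_minor_1:
  assumes g: "g \<in> carrier_mat n n" and "i < n"
  shows "left_justified_minor g {i} = g $$ (i, 0)"
proof -
  have "pick {i} 0 = i"
    by (auto intro!: Least_equality)
  then show ?thesis
    using assms by (subst left_justified_minor_eq_det[OF g]) (auto simp: det_single)
qed

lemma det_2_by_2:
  assumes A: "A \<in> carrier_mat 2 2"
  shows "det A = A $$ (0, 0) * A $$ (1, 1) - A $$ (0, 1) * (A $$ (1, 0) :: 'a::comm_ring_1)"
proof -
  have "mat_delete A 0 j \<in> carrier_mat 1 1" for j
    using mat_delete_carrier[OF A] by simp
  then have del: "det (mat_delete A 0 j) = mat_delete A 0 j $$ (0, 0)" for j
    by (rule det_single)
  have "det A = (\<Sum>j<2. A $$ (0, j) * cofactor A 0 j)"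
    using A by (rule laplace_expansion_row) simp
  also have "\<dots> = A $$ (0, 0) * mat_delete A 0 0 $$ (0, 0) - A $$ (0, 1) * mat_delete A 0 1 $$ (0, 0)"
    by (simp add: numeral_2_eq_2 cofactor_def del)
  also have "\<dots> = A $$ (0, 0) * A $$ (1, 1) - A $$ (0, 1) * A $$ (1, 0)"
    using A by (simp add: mat_delete_def)
  finally show ?thesis .
qed

lemma left_justified_minor_2:
  assumes g: "g \<in> carrier_mat n n" and ab: "a < b" "b < n"
  shows "left_justified_minor g {a, b} = g $$ (a, 0) * g $$ (b, 1) - g $$ (a, 1) * g $$ (b, 0)"
proof -
  let ?A = "mat 2 2 (\<lambda>(i, j). g $$ (pick {a, b} i, j))"
  have card: "card {a, b} = 2"
    using ab by simp
  have "{a, b} \<subseteq> {..<n}"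
    using ab by auto
  then have "left_justified_minor g {a, b} = det ?A"
    by (simp only: left_justified_minor_eq_det[OF g] card)
  also have "\<dots> = g $$ (a, 0) * g $$ (b, 1) - g $$ (a, 1) * g $$ (b, 0)"
    using pick_insert2[OF ab(1)] by (simp add: det_2_by_2 del: pick.simps)
  finally show ?thesis .
qed

text \<open>The unknown column scaling \<open>u\<close> cancels in the quotient. Nonnegativity is
  recorded because it is the closed condition that passes to the limit t -> 0.\<close>

lemma positive_minor_ratio:
  assumes "a \<in> \<real>" "Re a > 0" "b \<in> \<real>" "Re b > 0" "a = x * u" "b = y * u"
  shows "x / y \<in> \<real>\<^sub>\<ge>\<^sub>0" "x \<noteq> 0"
proof -
  have "u \<noteq> 0" using assms by auto
  then have "x / y = a / b" by (simp add: assms)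
  moreover have "a = complex_of_real (Re a)" "b = complex_of_real (Re b)"
    using assms by (auto simp: complex_is_Real_iff complex_eq_iff)
  ultimately have "x / y = complex_of_real (Re a / Re b)" by (metis of_real_divide)
  then show "x / y \<in> \<real>\<^sub>\<ge>\<^sub>0"
    using assms by (metis divide_pos_pos less_imp_le nonneg_Reals_of_real_iff)
  show "x \<noteq> 0" using assms by auto
qed

text \<open>A positive frame of the same point differs from \<open>g\<close> by column factors, so
  all minors of size 1 change by the factor u 0 and all those of size 2 by u 0 * u 1.\<close>

lemma adj_orbit_pos_minor_ratios:
  assumes g: "g \<in> unitary_group n" and pos: "conj_diag n lam g \<in> adj_orbit_pos n lam"
    and lam: "\<And>i j. i < n \<Longrightarrow> j < n \<Longrightarrow> i \<noteq> j \<Longrightarrow> lam i \<noteq> lam j" and n: "n \<ge> 2"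
  shows "i < n \<Longrightarrow> g $$ (i, 0) \<noteq> 0"
    and "i < n \<Longrightarrow> g $$ (i, 0) / g $$ (0, 0) \<in> \<real>\<^sub>\<ge>\<^sub>0"
    and "a < b \<Longrightarrow> b < n \<Longrightarrow> (g $$ (a, 0) * g $$ (b, 1) - g $$ (a, 1) * g $$ (b, 0)) /
      (g $$ (0, 0) * g $$ (1, 1) - g $$ (0, 1) * g $$ (1, 0)) \<in> \<real>\<^sub>\<ge>\<^sub>0"
proof -
  obtain h where h: "h \<in> unitary_pos n" "conj_diag n lam g = conj_diag n lam h"
    using pos by (auto simp: adj_orbit_pos_def)
  then have hu: "h \<in> unitary_group n"
    by (simp add: unitary_pos_def)
  note hc = unitary_group_carrier[OF hu]
  have minor: "left_justified_minor h I \<in> \<real>" "Re (left_justified_minor h I) > 0" if "I \<subseteq> {..<n}" for I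
    using h(1) that by (auto simp: unitary_pos_def)
  obtain u where u: "\<And>i j. i < n \<Longrightarrow> j < n \<Longrightarrow> h $$ (i, j) = g $$ (i, j) * u j"
    using conj_diag_eq_imp_column_scaling[OF g hu h(2) lam] by blast
  have m1: "left_justified_minor h {i} = g $$ (i, 0) * u 0" if "i < n" for i
    using that by (simp add: left_justified_minor_1[OF hc] u)
  have m2: "left_justified_minor h {a, b} = (g $$ (a, 0) * g $$ (b, 1) - g $$ (a, 1) * g $$ (b, 0)) * (u 0 * u 1)"
    if "a < b" "b < n" for a b
    using that n by (simp add: left_justified_minor_2[OF hc] u algebra_simps)
  show "i < n \<Longrightarrow> g $$ (i, 0) \<noteq> 0" "i < n \<Longrightarrow> g $$ (i, 0) / g $$ (0, 0) \<in> \<real>\<^sub>\<ge>\<^sub>0"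
    using positive_minor_ratio[OF minor[of "{i}"] minor[of "{0}"] m1 m1] n by auto
  show "a < b \<Longrightarrow> b < n \<Longrightarrow> (g $$ (a, 0) * g $$ (b, 1) - g $$ (a, 1) * g $$ (b, 0)) /
      (g $$ (0, 0) * g $$ (1, 1) - g $$ (0, 1) * g $$ (1, 0)) \<in> \<real>\<^sub>\<ge>\<^sub>0"
    using positive_minor_ratio(1)[OF minor[of "{a, b}"] minor[of "{0, 1}"] m2 m2] n by auto
qed

text \<open>For t > 0 the numbers f(t) / (t h(t)) lie in the closed set of nonnegative reals, and
  they tend to z / p. Reality and sign of the derivative come out together.\<close>

lemma nonneg_Reals_derivative:
  fixes f h :: "real \<Rightarrow> complex"
  assumes f: "(f has_vector_derivative z) (at 0)" "f 0 = 0"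
    and h: "isCont h 0" "h 0 = complex_of_real p" "p > 0"
    and quot: "\<And>t. t > 0 \<Longrightarrow> f t / h t \<in> \<real>\<^sub>\<ge>\<^sub>0"
  shows "z \<in> \<real>\<^sub>\<ge>\<^sub>0"
proof -
  have "((\<lambda>t. norm (f t - t *\<^sub>R z) / norm t) \<longlongrightarrow> 0) (at 0)"
    using f unfolding has_vector_derivative_def has_derivative_iff_norm by simp
  moreover have "norm (f t - t *\<^sub>R z) / norm t = norm (f t /\<^sub>R t - z)" if "t \<noteq> 0" for t
  proof -
    have "f t /\<^sub>R t - z = (f t - t *\<^sub>R z) /\<^sub>R t"
      using that by (simp add: scaleR_diff_right)
    then show ?thesis
      by (simp add: divide_inverse)
  qed
  then have "\<forall>\<^sub>F t in at 0. norm (f t - t *\<^sub>R z) / norm t = norm (f t /\<^sub>R t - z)"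
    by (simp add: eventually_at_filter)
  ultimately have "((\<lambda>t. norm (f t /\<^sub>R t - z)) \<longlongrightarrow> 0) (at 0)"
    by (rule Lim_transform_eventually)
  then have "((\<lambda>t. f t /\<^sub>R t) \<longlongrightarrow> z) (at 0)"
    by (simp add: tendsto_norm_zero_iff LIM_zero_iff)
  then have "((\<lambda>t. f t /\<^sub>R t) \<longlongrightarrow> z) (at_right 0)"
    by (rule tendsto_mono[OF at_le[OF subset_UNIV]])
  moreover have "(h \<longlongrightarrow> complex_of_real p) (at_right 0)"
    using h(1,2) by (auto simp: isCont_def intro: tendsto_mono[OF at_le[OF subset_UNIV]])
  ultimately have "((\<lambda>t. f t /\<^sub>R t / h t) \<longlongrightarrow> z / complex_of_real p) (at_right 0)"
    using h by (intro tendsto_divide) auto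
  moreover have "\<forall>\<^sub>F t in at_right 0. f t /\<^sub>R t / h t \<in> \<real>\<^sub>\<ge>\<^sub>0"
    using eventually_at_right_less
  proof eventually_elim
    case (elim t)
    then have "complex_of_real (inverse t) * (f t / h t) \<in> \<real>\<^sub>\<ge>\<^sub>0"
      using quot[OF elim] by (intro nonneg_Reals_mult_I) (auto simp: nonneg_Reals_of_real_iff simp del: of_real_inverse)
    then show ?case by (simp add: scaleR_conv_of_real)
  qed
  ultimately have "z / complex_of_real p \<in> \<real>\<^sub>\<ge>\<^sub>0"
    by (intro Lim_in_closed_set[OF closed_nonneg_Reals_complex _ trivial_limit_at_right_real])
  then have "complex_of_real p * (z / complex_of_real p) \<in> \<real>\<^sub>\<ge>\<^sub>0"
    using h by (intro nonneg_Reals_mult_I) (auto simp: nonneg_Reals_of_real_iff)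
  with h show ?thesis by simp
qed

section \<open>First-order conditions at the boundary\<close>

text \<open>Column 0 of the rotation g is e_0, so column 0 of g* N g is g* applied to column 0 of N;
  no other column of N enters.\<close>

lemma frame_velocity_rotation12_col0:
  assumes n: "n \<ge> 3" and N: "N \<in> carrier_mat n n" and k: "k < n"
  shows "frame_velocity n lam N (cmat n (rotation12 c s)) $$ (k, 0) =
    ((lam 0 - lam k) / (2 * real n)) *\<^sub>R (\<Sum>l<n. rotation12 c s l k *\<^sub>R (\<i> * N $$ (l, 0)))"
proof -
  define g where "g = cmat n (rotation12 c s)"
  have g: "g \<in> carrier_mat n n"
    by (simp add: g_def cmat_def)
  have gN: "mat_adjoint g * N \<in> carrier_mat n n"
    using g N by (intro mult_carrier_mat[of _ n n]) auto
  have n0: "0 < n" using n by simp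
  have "(mat_adjoint g * N * g) $$ (k, 0) = (\<Sum>l<n. if l = 0 then (mat_adjoint g * N) $$ (k, 0) else 0)"
    unfolding index_mult_mat_sum[OF gN g k n0]
    by (intro sum.cong) (auto simp: g_def cmat_def rotation12_def)
  also have "\<dots> = (mat_adjoint g * N) $$ (k, 0)"
    using n0 by simp
  also have "\<dots> = (\<Sum>l<n. rotation12 c s l k *\<^sub>R N $$ (l, 0))"
    unfolding index_mult_mat_sum[OF mat_adjoint_carrier[OF g] N k n0] using k
    by (intro sum.cong) (auto simp: g_def cmat_def scaleR_conv_of_real)
  finally have entry: "(mat_adjoint g * N * g) $$ (k, 0) = (\<Sum>l<n. rotation12 c s l k *\<^sub>R N $$ (l, 0))" .
  show ?thesis
    unfolding g_def[symmetric] frame_velocity_index[OF g N k n0] entry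
    by (simp add: scaleR_conv_of_real sum_distrib_left sum_divide_distrib mult_ac)
qed

lemma rotation12_transpose: "rotation12 c s i j = rotation12 c (- s) j i"
  by (cases "i = 1"; cases "i = 2"; cases "j = 1"; cases "j = 2") (simp_all add: rotation12_def)

lemma rotation12_mult_col0:
  assumes "n \<ge> 3" "K \<in> carrier_mat n n" "i < n"
  shows "(cmat n (rotation12 c s) * K) $$ (i, 0) =
    (if i = 1 then c *\<^sub>R K $$ (1, 0) - s *\<^sub>R K $$ (2, 0)
     else if i = 2 then c *\<^sub>R K $$ (2, 0) + s *\<^sub>R K $$ (1, 0) else K $$ (i, 0))"
proof -
  have "(cmat n (rotation12 c s) * K) $$ (i, 0) = (\<Sum>k<n. rotation12 c (- s) k i *\<^sub>R K $$ (k, 0))"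
    using assms
    by (subst index_mult_mat_sum[of _ n n _ n])
      (simp_all add: cmat_def scaleR_conv_of_real rotation12_transpose[of c s i])
  then show ?thesis
    unfolding sum_rotation12[OF assms(1,3)] by simp
qed

text \<open>At time 0 the entries (i,0) with i > 0 vanish, and with them the minors on {1,i},
  whereas the reference minors on {0} and {0,1} equal 1 and c. In the product rule for the minor on
  {1,i} only the velocities of column 0 survive.\<close>

lemma strict_positivity_first_order:
  assumes n: "n \<ge> 3" and N: "N \<in> skew_hermitian n"
    and lam: "\<And>i j. i < n \<Longrightarrow> j < n \<Longrightarrow> i \<noteq> j \<Longrightarrow> lam i \<noteq> lam j"
    and pos: "strictly_preserves_positivity n lam (gradient_flow n lam (\<lambda>L. Re (mat_trace (L * N))))"
    and cs: "c > 0" "s > 0" "c\<^sup>2 + s\<^sup>2 = 1"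
  defines "V \<equiv> cmat n (rotation12 c s) * frame_velocity n lam N (cmat n (rotation12 c s))"
  shows "0 < i \<Longrightarrow> i < n \<Longrightarrow> V $$ (i, 0) \<in> \<real>\<^sub>\<ge>\<^sub>0"
    and "2 \<le> i \<Longrightarrow> i < n \<Longrightarrow> rotation12 c s i 1 *\<^sub>R V $$ (1, 0) - c *\<^sub>R V $$ (i, 0) \<in> \<real>\<^sub>\<ge>\<^sub>0"
proof -
  define g0 where "g0 = cmat n (rotation12 c s)"
  have g0: "g0 \<in> unitary_group n"
    unfolding g0_def by (rule orthonormal_cmat_unitary[OF rotation12_orthonormal[OF n cs(3)]])
  have g0_index: "g0 $$ (i, j) = complex_of_real (rotation12 c s i j)" if "i < n" "j < n" for i j
    using that by (simp add: g0_def cmat_def)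
  obtain g where g: "g 0 = g0" "\<And>t. g t \<in> unitary_group n"
    "\<And>t. has_mat_derivative n g (g t * frame_velocity n lam N (g t)) t"
    "(\<lambda>t. conj_diag n lam (g t)) \<in> gradient_flow n lam (\<lambda>L. Re (mat_trace (L * N)))"
    using gradient_flow_trajectory[where S = UNIV and lam = lam, OF _ N g0 lam] n by auto
  have "conj_diag n lam (g 0) \<in> adj_orbit_nonneg n lam"
    unfolding g(1) g0_def by (rule conj_diag_rotation12_nonneg[OF n cs])
  then have "conj_diag n lam (g t) \<in> adj_orbit_pos n lam" if "t > 0" for t
    using bspec[OF pos[unfolded strictly_preserves_positivity_def] g(4)] that by simp
  note ratios = adj_orbit_pos_minor_ratios[OF g(2) this lam]
  have deriv: "((\<lambda>t. g t $$ (i, j)) has_vector_derivative V $$ (i, j)) (at 0)" if "i < n" "j < n" for i j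
    using has_mat_derivative_index[OF g(3) that, of 0] by (simp add: V_def g(1) g0_def)
  have cont: "isCont (\<lambda>t. g t $$ (i, j)) 0" if "i < n" "j < n" for i j
    by (rule has_vector_derivative_continuous[OF deriv[OF that]])
  show "V $$ (i, 0) \<in> \<real>\<^sub>\<ge>\<^sub>0" if i: "0 < i" "i < n"
  proof (rule nonneg_Reals_derivative[where p = 1])
    show "((\<lambda>t. g t $$ (i, 0)) has_vector_derivative V $$ (i, 0)) (at 0)"
      using i by (intro deriv) auto
    show "isCont (\<lambda>t. g t $$ (0, 0)) 0"
      using n by (intro cont) auto
    show "g 0 $$ (i, 0) = 0" "g 0 $$ (0, 0) = complex_of_real 1"
      using i n by (simp_all add: g(1) g0_index rotation12_def)
    show "g t $$ (i, 0) / g t $$ (0, 0) \<in> \<real>\<^sub>\<ge>\<^sub>0" if "t > 0" for t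
      using ratios(2)[OF that, of i] i n by simp
  qed simp
  show "rotation12 c s i 1 *\<^sub>R V $$ (1, 0) - c *\<^sub>R V $$ (i, 0) \<in> \<real>\<^sub>\<ge>\<^sub>0" if i: "2 \<le> i" "i < n"
  proof (rule nonneg_Reals_derivative[where p = c])
    have "((\<lambda>t. g t $$ (1, 0) * g t $$ (i, 1) - g t $$ (1, 1) * g t $$ (i, 0)) has_vector_derivative
        (g 0 $$ (1, 0) * V $$ (i, 1) + V $$ (1, 0) * g 0 $$ (i, 1))
        - (g 0 $$ (1, 1) * V $$ (i, 0) + V $$ (1, 1) * g 0 $$ (i, 0))) (at 0)"
      using i n by (intro has_vector_derivative_diff has_vector_derivative_mult deriv) auto
    then show "((\<lambda>t. g t $$ (1, 0) * g t $$ (i, 1) - g t $$ (1, 1) * g t $$ (i, 0)) has_vector_derivative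
        rotation12 c s i 1 *\<^sub>R V $$ (1, 0) - c *\<^sub>R V $$ (i, 0)) (at 0)"
      using i n by (simp add: g(1) g0_index rotation12_def scaleR_conv_of_real mult.commute split: if_splits)
    show "isCont (\<lambda>t. g t $$ (0, 0) * g t $$ (1, 1) - g t $$ (0, 1) * g t $$ (1, 0)) 0"
      using n by (intro continuous_intros cont) auto
    show "g 0 $$ (1, 0) * g 0 $$ (i, 1) - g 0 $$ (1, 1) * g 0 $$ (i, 0) = 0"
      "g 0 $$ (0, 0) * g 0 $$ (1, 1) - g 0 $$ (0, 1) * g 0 $$ (1, 0) = complex_of_real c"
      using i n by (simp_all add: g(1) g0_index rotation12_def)
    show "(g t $$ (1, 0) * g t $$ (i, 1) - g t $$ (1, 1) * g t $$ (i, 0)) /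
        (g t $$ (0, 0) * g t $$ (1, 1) - g t $$ (0, 1) * g t $$ (1, 0)) \<in> \<real>\<^sub>\<ge>\<^sub>0" if "t > 0" for t
      using ratios(3)[OF that, of 1 i] i n by simp
  qed (rule cs)
qed

text \<open>In terms of the tangent of the angle, tangent 1 forces x >= y >= 0, a small tangent then
  forces y = 0, and tangent 1 once more leaves (k1 - k2) x >= 0. The last step is where k1 < k2 is
  decisive: for k1 = k2, every x >= 0 with y = 0 satisfies both inequalities.\<close>

lemma rotation_inequalities_imp_zero:
  fixes x y k1 k2 :: real
  assumes k: "0 < k1" "k1 < k2"
    and ineq: "\<And>c s. c > 0 \<Longrightarrow> s > 0 \<Longrightarrow> c\<^sup>2 + s\<^sup>2 = 1 \<Longrightarrow>
      0 \<le> c * (k2 * (c * y - s * x)) + s * (k1 * (c * x + s * y)) \<and> k2 * (c * y - s * x) \<le> 0"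
  shows "x = 0 \<and> y = 0"
proof -
  have *: "0 \<le> k2 * (y - \<tau> * x) + \<tau> * (k1 * (x + \<tau> * y)) \<and> y \<le> \<tau> * x" if \<tau>: "\<tau> > 0" for \<tau>
  proof -
    \<comment> \<open>The cosine of the acute angle with tangent \<open>\<tau>\<close>; its square
      factors out of the first inequality.\<close>
    define c where "c = 1 / sqrt (1 + \<tau>\<^sup>2)"
    have pos: "1 + \<tau>\<^sup>2 > 0" by (simp add: add_pos_nonneg)
    then have c: "c > 0" by (simp add: c_def)
    have "c\<^sup>2 * (1 + \<tau>\<^sup>2) = 1"
      using pos by (simp add: c_def power_divide)
    then have "c\<^sup>2 + (\<tau> * c)\<^sup>2 = 1"
      by (simp add: power_mult_distrib algebra_simps)
    from ineq[OF c _ this] \<tau> c have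
      1: "0 \<le> c * (k2 * (c * y - \<tau> * c * x)) + \<tau> * c * (k1 * (c * x + \<tau> * c * y))"
      and 2: "k2 * (c * y - \<tau> * c * x) \<le> 0"
      by auto
    have "c * (k2 * (c * y - \<tau> * c * x)) + \<tau> * c * (k1 * (c * x + \<tau> * c * y))
        = c\<^sup>2 * (k2 * (y - \<tau> * x) + \<tau> * (k1 * (x + \<tau> * y)))"
      by (simp add: power2_eq_square algebra_simps)
    with 1 c have "0 \<le> k2 * (y - \<tau> * x) + \<tau> * (k1 * (x + \<tau> * y))"
      by (simp add: zero_le_mult_iff)
    moreover have "k2 * (c * y - \<tau> * c * x) = (k2 * c) * (y - \<tau> * x)"
      by (simp add: algebra_simps)
    with 2 k c have "y - \<tau> * x \<le> 0"
      by (simp add: mult_le_0_iff)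
    ultimately show ?thesis by simp
  qed
  have "(k2 - k1) * (x - y) \<ge> 0"
    using *[of 1] k by simp
  moreover have "0 \<le> k2 * (y - x) + k1 * (x + y)"
    using *[of 1] by simp
  then have "0 \<le> 2 * k1 * y - (k2 - k1) * (x - y)"
    by (simp add: algebra_simps)
  ultimately have "0 \<le> 2 * k1 * y"
    by linarith
  then have y: "y \<ge> 0"
    using k by (simp add: zero_le_mult_iff)
  then have x: "x \<ge> 0"
    using *[of 1] by simp
  \<comment> \<open>The angle with tangent y / (2x) turns the second inequality into y <= y /
    2.\<close>
  have "y = 0"
  proof (rule ccontr)
    assume "y \<noteq> 0"
    with y have "y > 0" by simp
    then have "x > 0" using *[of 1] by simp
    with \<open>y > 0\<close> *[of "y / (2 * x)"] show False by simp
  qed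
  moreover have "x \<le> 0"
  proof -
    have "0 \<le> (k1 - k2) * x"
      using *[of 1] \<open>y = 0\<close> by (simp add: algebra_simps)
    with k show ?thesis by (simp add: zero_le_mult_iff)
  qed
  ultimately show ?thesis using x by simp
qed

lemma strict_positivity_imp_off_diagonal_zero:
  assumes n: "n \<ge> 3" and N: "N \<in> skew_hermitian n"
    and lam: "\<And>i j. i < j \<Longrightarrow> j < n \<Longrightarrow> lam j < lam i"
    and pos: "strictly_preserves_positivity n lam (gradient_flow n lam (\<lambda>L. Re (mat_trace (L * N))))"
    and i: "0 < i" "i < n"
  shows "N $$ (i, 0) = 0"
proof -
  note Nc = skew_hermitian_carrier[OF N]
  have distinct: "lam i \<noteq> lam j" if "i < n" "j < n" "i \<noteq> j" for i j
    using lam[of i j] lam[of j i] that by (cases i j rule: linorder_cases) auto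
  \<comment> \<open>Absorbs the imaginary unit of the frame velocity, so that the coefficients of
    the first-order conditions are real.\<close>
  define m where "m l = \<i> * N $$ (l, 0)" for l
  define k where "k l = (lam 0 - lam l) / (2 * real n)" for l
  have k: "0 < k 1" "k 1 < k 2" "l < n \<Longrightarrow> 0 < l \<Longrightarrow> 0 < k l" for l
    using lam[of 0 1] lam[of 1 2] lam[of 0 l] n by (auto simp: k_def divide_simps)
  define K where "K c s = frame_velocity n lam N (cmat n (rotation12 c s))" for c s
  have cm: "cmat n Q \<in> carrier_mat n n" for Q
    by (simp add: cmat_def)
  have Kc: "K c s \<in> carrier_mat n n" for c s
    unfolding K_def by (intro skew_hermitian_carrier frame_velocity_skew[OF cm N])
  have K0: "K c s $$ (l, 0) = k l *\<^sub>R (if l = 1 then c *\<^sub>R m 1 + s *\<^sub>R m 2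
      else if l = 2 then c *\<^sub>R m 2 - s *\<^sub>R m 1 else m l)" if "l < n" for c s l
    unfolding K_def frame_velocity_rotation12_col0[OF n Nc that] sum_rotation12[OF n that]
    by (simp add: k_def m_def)
  note V0 = rotation12_mult_col0[OF n Kc]
  have first_order:
    "0 < i \<Longrightarrow> i < n \<Longrightarrow> (cmat n (rotation12 c s) * K c s) $$ (i, 0) \<in> \<real>\<^sub>\<ge>\<^sub>0"
    "2 \<le> i \<Longrightarrow> i < n \<Longrightarrow> rotation12 c s i 1 *\<^sub>R (cmat n (rotation12 c s) * K c s) $$ (1, 0)
      - c *\<^sub>R (cmat n (rotation12 c s) * K c s) $$ (i, 0) \<in> \<real>\<^sub>\<ge>\<^sub>0"
    if "c > 0" "s > 0" "c\<^sup>2 + s\<^sup>2 = 1" for c s i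
    unfolding K_def using strict_positivity_first_order[where lam = lam, OF n N _ pos that] distinct
    by blast+
  have m12: "m 1 = 0 \<and> m 2 = 0"
  proof -
    have V2: "c *\<^sub>R (k 2 *\<^sub>R (c *\<^sub>R m 2 - s *\<^sub>R m 1)) + s *\<^sub>R (k 1 *\<^sub>R (c *\<^sub>R m 1 + s *\<^sub>R m 2)) \<in> \<real>\<^sub>\<ge>\<^sub>0"
      and K2: "- (k 2 *\<^sub>R (c *\<^sub>R m 2 - s *\<^sub>R m 1)) \<in> \<real>\<^sub>\<ge>\<^sub>0"
      if cs: "c > 0" "s > 0" "c\<^sup>2 + s\<^sup>2 = 1" for c s
    proof -
      have K12: "K c s $$ (1, 0) = k 1 *\<^sub>R (c *\<^sub>R m 1 + s *\<^sub>R m 2)"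
        "K c s $$ (2, 0) = k 2 *\<^sub>R (c *\<^sub>R m 2 - s *\<^sub>R m 1)"
        using n by (simp_all add: K0)
      have "c *\<^sub>R K c s $$ (2, 0) + s *\<^sub>R K c s $$ (1, 0) \<in> \<real>\<^sub>\<ge>\<^sub>0"
        using first_order(1)[OF cs, of 2] V0[of 2 c s c s] n by simp
      then show "c *\<^sub>R (k 2 *\<^sub>R (c *\<^sub>R m 2 - s *\<^sub>R m 1)) + s *\<^sub>R (k 1 *\<^sub>R (c *\<^sub>R m 1 + s *\<^sub>R m 2)) \<in> \<real>\<^sub>\<ge>\<^sub>0"
        unfolding K12 .
      \<comment> \<open>For the minor on rows 1 and 2 the rotation cancels against the minor's own
        coefficients, leaving minus the entry (2,0) of the velocity \<open>K\<close> in the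
        frame.\<close>
      have "s *\<^sub>R (c *\<^sub>R K c s $$ (1, 0) - s *\<^sub>R K c s $$ (2, 0))
          - c *\<^sub>R (c *\<^sub>R K c s $$ (2, 0) + s *\<^sub>R K c s $$ (1, 0)) \<in> \<real>\<^sub>\<ge>\<^sub>0"
        using first_order(2)[OF cs, of 2] V0[of 2 c s c s] V0[of 1 c s c s] n by (simp add: rotation12_def)
      also have "s *\<^sub>R (c *\<^sub>R K c s $$ (1, 0) - s *\<^sub>R K c s $$ (2, 0))
          - c *\<^sub>R (c *\<^sub>R K c s $$ (2, 0) + s *\<^sub>R K c s $$ (1, 0)) = - ((c\<^sup>2 + s\<^sup>2) *\<^sub>R K c s $$ (2, 0))"
        by (simp add: scaleR_conv_of_real power2_eq_square algebra_simps)
      finally show "- (k 2 *\<^sub>R (c *\<^sub>R m 2 - s *\<^sub>R m 1)) \<in> \<real>\<^sub>\<ge>\<^sub>0"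
        using cs(3) K12 by simp
    qed
    have "Re (m 1) = 0 \<and> Re (m 2) = 0"
    proof (rule rotation_inequalities_imp_zero[OF k(1,2)])
      fix c s :: real assume cs: "c > 0" "s > 0" "c\<^sup>2 + s\<^sup>2 = 1"
      from V2[OF cs] K2[OF cs]
      show "0 \<le> c * (k 2 * (c * Re (m 2) - s * Re (m 1))) + s * (k 1 * (c * Re (m 1) + s * Re (m 2)))
          \<and> k 2 * (c * Re (m 2) - s * Re (m 1)) \<le> 0"
        unfolding complex_nonneg_Reals_iff by auto
    qed
    \<comment> \<open>Nonnegative reals have imaginary part 0, so the same inequalities hold for the
      imaginary parts, as equalities.\<close>
    moreover have "Im (m 1) = 0 \<and> Im (m 2) = 0"
    proof (rule rotation_inequalities_imp_zero[OF k(1,2)])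
      fix c s :: real assume cs: "c > 0" "s > 0" "c\<^sup>2 + s\<^sup>2 = 1"
      from V2[OF cs] K2[OF cs]
      show "0 \<le> c * (k 2 * (c * Im (m 2) - s * Im (m 1))) + s * (k 1 * (c * Im (m 1) + s * Im (m 2)))
          \<and> k 2 * (c * Im (m 2) - s * Im (m 1)) \<le> 0"
        unfolding complex_nonneg_Reals_iff by auto
    qed
    ultimately show ?thesis
      by (simp add: complex_eq_iff)
  qed
  have "m i = 0"
  proof (cases "i \<le> 2")
    case True
    with i have "i = 1 \<or> i = 2" by auto
    with m12 show ?thesis by auto
  next
    case False
    \<comment> \<open>Any acute angle serves, and 3/5, 4/5 keep it rational. A row i > 2 is fixed by
      the rotation, so the minors on {i} and {1,i} have derivatives of opposite sign, and both must
      be nonnegative.\<close>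
    define c s :: real where "c = 3 / 5" and "s = 4 / 5"
    have cs: "c > 0" "s > 0" "c\<^sup>2 + s\<^sup>2 = 1"
      by (simp_all add: c_def s_def power2_eq_square)
    have V: "(cmat n (rotation12 c s) * K c s) $$ (i, 0) = k i *\<^sub>R m i"
      using V0[OF i(2), of c s c s] False K0[OF i(2)] by simp
    have "k i *\<^sub>R m i \<in> \<real>\<^sub>\<ge>\<^sub>0"
      using first_order(1)[OF cs i] V by simp
    moreover have "rotation12 c s i 1 = 0"
      using False by (simp add: rotation12_def)
    then have "- (c *\<^sub>R (k i *\<^sub>R m i)) \<in> \<real>\<^sub>\<ge>\<^sub>0"
      using first_order(2)[OF cs, of i] False i V by simp
    ultimately have "k i * Re (m i) = 0 \<and> k i * Im (m i) = 0"
      using cs by (auto simp: complex_nonneg_Reals_iff mult_le_0_iff zero_le_mult_iff)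
    with k(3)[OF i(2,1)] show ?thesis
      by (auto simp: complex_eq_iff)
  qed
  then show ?thesis
    by (simp add: m_def)
qed

text \<open>Block diagonal matrices for e_0 and its orthogonal complement. They form an algebra
  closed under adjoints, and the frame velocity rescales entries, so the vector field stays tangent
  to them when N is of this kind.\<close>

definition splits_first_axis :: "nat \<Rightarrow> complex mat \<Rightarrow> bool" where
  "splits_first_axis n A \<longleftrightarrow> A \<in> carrier_mat n n \<and>
     (\<forall>i<n. \<forall>j<n. (i = 0) \<noteq> (j = 0) \<longrightarrow> A $$ (i, j) = 0)"

lemma splits_first_axis_mult:
  assumes "splits_first_axis n A" "splits_first_axis n B"
  shows "splits_first_axis n (A * B)"
proof -
  have c: "A \<in> carrier_mat n n" "B \<in> carrier_mat n n"
    using assms by (auto simp: splits_first_axis_def)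
  have "(A * B) $$ (i, j) = 0" if ij: "i < n" "j < n" "(i = 0) \<noteq> (j = 0)" for i j
  proof -
    have "A $$ (i, l) * B $$ (l, j) = 0" if "l < n" for l
      using assms ij that unfolding splits_first_axis_def by (cases "(i = 0) = (l = 0)") auto
    then show ?thesis
      unfolding index_mult_mat_sum[OF c ij(1,2)] by (intro sum.neutral) auto
  qed
  then show ?thesis
    using c by (auto simp: splits_first_axis_def intro: mult_carrier_mat)
qed

lemma splits_first_axis_adjoint: "splits_first_axis n A \<Longrightarrow> splits_first_axis n (mat_adjoint A)"
  by (auto simp: splits_first_axis_def)

lemma splits_first_axis_frame_velocity:
  assumes "splits_first_axis n N" "splits_first_axis n y"
  shows "splits_first_axis n (frame_velocity n lam N y)"
proof -
  have c: "N \<in> carrier_mat n n" "y \<in> carrier_mat n n"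
    using assms by (auto simp: splits_first_axis_def)
  have c': "mat_adjoint y * N * y \<in> carrier_mat n n"
    using c by (intro mult_carrier_mat[of _ n n]) auto
  have "splits_first_axis n (mat_adjoint y * N * y)"
    using assms by (intro splits_first_axis_mult splits_first_axis_adjoint)
  then show ?thesis
    using c c' frame_velocity_index[OF c(2,1)]
    by (auto simp: splits_first_axis_def frame_velocity_def)
qed

theorem theorem1p5:
  fixes n :: nat and lam :: "nat \<Rightarrow> real" and N :: "complex mat"
  assumes "n \<ge> 3"
    and "\<And>i j. i < j \<Longrightarrow> j < n \<Longrightarrow> lam j < lam i"
    and "N \<in> skew_hermitian n"
  shows "\<not> strictly_preserves_positivity n lam
           (gradient_flow n lam (\<lambda>L. Re (mat_trace (L * N))))"
proof
  assume pos: "strictly_preserves_positivity n lam (gradient_flow n lam (\<lambda>L. Re (mat_trace (L * N))))"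
  have distinct: "lam i \<noteq> lam j" if "i < n" "j < n" "i \<noteq> j" for i j
    using assms(2)[of i j] assms(2)[of j i] that by (cases i j rule: linorder_cases) auto
  have N0: "N $$ (i, 0) = 0" if "0 < i" "i < n" for i
    using strict_positivity_imp_off_diagonal_zero[OF assms(1,3,2) pos that] .
  then have "N $$ (0, i) = 0" if "0 < i" "i < n" for i
    using skew_hermitian_index[OF assms(3), of i 0] that by simp
  with N0 have N: "splits_first_axis n N"
    using skew_hermitian_carrier[OF assms(3)] by (auto simp: splits_first_axis_def)
  define c s :: real where "c = 3 / 5" and "s = 4 / 5"
  have cs: "c > 0" "s > 0" "c\<^sup>2 + s\<^sup>2 = 1"
    by (simp_all add: c_def s_def power2_eq_square)
  define g0 where "g0 = cmat n (rotation12 c s)"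
  have g0: "g0 \<in> unitary_group n"
    unfolding g0_def by (rule orthonormal_cmat_unitary[OF rotation12_orthonormal[OF assms(1) cs(3)]])
  \<comment> \<open>The block pattern of \<open>splits_first_axis\<close> as a support condition;
    the rotation has it as well, so a trajectory can be built within it.\<close>
  define S where "S = {(i :: nat, j :: nat). (i = 0) = (j = 0)}"
  have supp0: "g0 $$ (i, j) = 0" if "i < n" "j < n" "(i, j) \<notin> S" for i j
    using that by (auto simp: g0_def cmat_def rotation12_def S_def)
  have supp: "(y * frame_velocity n lam N y) $$ (i, j) = 0"
    if y: "y \<in> carrier_mat n n" "\<And>i j. i < n \<Longrightarrow> j < n \<Longrightarrow> (i, j) \<notin> S \<Longrightarrow> y $$ (i, j) = 0"
      and ij: "i < n" "j < n" "(i, j) \<notin> S" for y i j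
  proof -
    have "splits_first_axis n y"
      using y by (auto simp: splits_first_axis_def S_def)
    then have "splits_first_axis n (y * frame_velocity n lam N y)"
      using N by (intro splits_first_axis_mult splits_first_axis_frame_velocity)
    with ij show ?thesis
      by (auto simp: splits_first_axis_def S_def)
  qed
  have "0 < n"
    using assms(1) by simp
  then obtain g where g: "g 0 = g0" "\<And>t. g t \<in> unitary_group n"
    "\<And>t. has_mat_derivative n g (g t * frame_velocity n lam N (g t)) t"
    "\<And>t i j. i < n \<Longrightarrow> j < n \<Longrightarrow> (i, j) \<notin> S \<Longrightarrow> g t $$ (i, j) = 0"
    "(\<lambda>t. conj_diag n lam (g t)) \<in> gradient_flow n lam (\<lambda>L. Re (mat_trace (L * N)))"
    using gradient_flow_trajectory[where S = S and lam = lam, OF _ assms(3) g0] distinct supp0 supp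
    by (smt (verit, best))
  have "conj_diag n lam (g 0) \<in> adj_orbit_nonneg n lam"
    unfolding g(1) g0_def by (rule conj_diag_rotation12_nonneg[OF assms(1) cs])
  then have "conj_diag n lam (g 1) \<in> adj_orbit_pos n lam"
    using bspec[OF pos[unfolded strictly_preserves_positivity_def] g(5)] by simp
  \<comment> \<open>A minor of size 1 of a positive frame is nonzero, yet the block pattern keeps
    this entry 0 at all times.\<close>
  then have "g 1 $$ (1, 0) \<noteq> 0"
    using adj_orbit_pos_minor_ratios(1)[where lam = lam and i = 1, OF g(2)] distinct assms(1) by auto
  moreover have "g 1 $$ (1, 0) = 0"
    using assms(1) by (intro g(4)) (auto simp: S_def)
  ultimately show False by simp
qed

end
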